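(* Let $p$ be a positive integer. For nonnegative integers $a,b$, let $A_b^a$ be the set of all strings containing $a$ times $p$ and $b$ times $2p$ (and nothing else). Then for any positive integers $k,l,l_1,l_2$ with $k,l,l_1\geqslant 2$ and any nonnegative integers $m,n,n_1,n_2$, the following four identities hold. (1) \begin{align*} &\zeta(k,\{p\}^m)\zeta(l,\{p\}^n)\\ =&\sum_{\substack{1\leqslant i\leqslant m\\ 0\leqslant j\leqslant\min\{m-i,n\}\\ \mathbf{k}\in A^{m+n-i-2j}_j}}\binom{m+n-i-2j}{n-j}\left[\zeta(k,\{p\}^i,l,\mathbf{k})+\zeta(k,\{p\}^{i-1},p+l,\mathbf{k})\right]\\ &+\sum_{\substack{1\leqslant i\leqslant n\\ 0\leqslant j\leqslant \min\{m,n-i\}\\ \mathbf{k}\in A^{m+n-i-2j}_j}}\binom{m+n-i-2j}{m-j}\left[\zeta(l,\{p\}^i,k,\mathbf{k})+\zeta(l,\{p\}^{i-1},p+k,\mathbf{k})\right]\\ &+\sum_{\substack{0\leqslant j\leqslant \min\{m,n\}\\ \mathbf{k}\in A^{m+n-2j}_j}}\binom{m+n-2j}{m-j}\left[\zeta(k,l,\mathbf{k})+\zeta(l,k,\mathbf{k})+\zeta(k+l,\mathbf{k})\right]. \end{align*} (2) \begin{align*} &\zeta^{\star}(k,\{p\}^m)\zeta^{\star}(l,\{p\}^n)\\ =&\sum_{\substack{1\leqslant i\leqslant m\\ 0\leqslant j\leqslant\min\{m-i,n\}\\ \mathbf{k}\in A^{m+n-i-2j}_j}}(-1)^j\binom{m+n-i-2j}{n-j}\left[\zeta^{\star}(k,\{p\}^i,l,\mathbf{k})-\zeta^{\star}(k,\{p\}^{i-1},p+l,\mathbf{k})\right]\\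 &+\sum_{\substack{1\leqslant i\leqslant n\\ 0\leqslant j\leqslant \min\{m,n-i\}\\ \mathbf{k}\in A^{m+n-i-2j}_j}}(-1)^j\binom{m+n-i-2j}{m-j}\left[\zeta^{\star}(l,\{p\}^i,k,\mathbf{k})-\zeta^{\star}(l,\{p\}^{i-1},p+k,\mathbf{k})\right]\\ &+\sum_{\substack{0\leqslant j\leqslant \min\{m,n\}\\ \mathbf{k}\in A^{m+n-2j}_j}}(-1)^j\binom{m+n-2j}{m-j}\left[\zeta^{\star}(k,l,\mathbf{k})+\zeta^{\star}(l,k,\mathbf{k})-\zeta^{\star}(k+l,\mathbf{k})\right]. \end{align*} (3) \begin{align*} &\zeta(k,\{p\}^m)\zeta(l_1,\{p\}^{n_1},l_2,\{p\}^{n_2})\\ =&\sum_{\substack{0\leqslant i_1\leqslant i_2\leqslant m\\ 0\leqslant j_1\leqslant \min\{i_2-i_1,n_1\}\\ 0\leqslant j_2\leqslant \min\{m-i_2,n_2\}\\ \mathbf{k}\in A^{n_1+i_2-i_1-2j_1}_{j_1}\\ \mathbf{l}\in A^{m+n_2-i_2-2j_2}_{j_2}}}\binom{n_1+i_2-i_1-2j_1}{n_1-j_1}\binom{m+n_2-i_2-2j_2}{n_2-j_2}\\ &\quad\times \left[\zeta(k,\{p\}^{i_1},l_1,\mathbf{k},l_2,\mathbf{l})+\zeta(k,\{p\}^{i_1-1},p+l_1,\mathbf{k},l_2,\mathbf{l})\right]\\ &+\sum_{\substack{0\leqslant i_1\leqslant i_2\leqslant m\\ 0\leqslant j_1\leqslant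 \min\{i_2-i_1-1,n_1\}\\ 0\leqslant j_2\leqslant \min\{m-i_2,n_2\}\\ \mathbf{k}\in A^{n_1+i_2-i_1-2j_1-1}_{j_1}\\ \mathbf{l}\in A^{m+n_2-i_2-2j_2}_{j_2}}}\binom{n_1+i_2-i_1-2j_1-1}{n_1-j_1}\binom{m+n_2-i_2-2j_2}{n_2-j_2}\\ &\quad\times \left[\zeta(k,\{p\}^{i_1},l_1,\mathbf{k},p+l_2,\mathbf{l})+\zeta(k,\{p\}^{i_1-1},p+l_1,\mathbf{k},p+l_2,\mathbf{l})\right]\\ &+\sum_{\substack{0\leqslant i_1\leqslant n_1,\;0\leqslant i_2\leqslant m\\ 0\leqslant j_1\leqslant \min\{i_2,n_1-i_1\}\\ 0\leqslant j_2\leqslant \min\{m-i_2,n_2\}\\ \mathbf{k}\in A^{n_1+i_2-i_1-2j_1}_{j_1}\\ \mathbf{l}\in A^{m+n_2-i_2-2j_2}_{j_2}}}\binom{n_1+i_2-i_1-2j_1}{i_2-j_1}\binom{m+n_2-i_2-2j_2}{n_2-j_2}\\ &\quad\times\left[\zeta(l_1,\{p\}^{i_1},k,\mathbf{k},l_2,\mathbf{l})+\zeta(l_1,\{p\}^{i_1-1},p+k,\mathbf{k},l_2,\mathbf{l})\right]\\ &+\sum_{\substack{0\leqslant i_1\leqslant n_1,\;0\leqslant i_2\leqslant m\\ 0\leqslant j_1\leqslant \min\{i_2-1,n_1-i_1\}\\ 0\leqslant j_2\leqslant \min\{m-i_2,n_2\}\\ \mathbf{k}\in A^{n_1+i_2-i_1-2j_1-1}_{j_1}\\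 \mathbf{l}\in A^{m+n_2-i_2-2j_2}_{j_2}}}\binom{n_1+i_2-i_1-2j_1-1}{i_2-j_1-1}\binom{m+n_2-i_2-2j_2}{n_2-j_2}\\ &\quad\times\left[\zeta(l_1,\{p\}^{i_1},k,\mathbf{k},p+l_2,\mathbf{l})+\zeta(l_1,\{p\}^{i_1-1},p+k,\mathbf{k},p+l_2,\mathbf{l})\right]\\ &+\sum_{\substack{0\leqslant j\leqslant \min\{m,n_2\}\\ \mathbf{k}\in A^{m+n_2-2j}_j}}\binom{m+n_2-2j}{m-j}\zeta(l_1,\{p\}^{n_1},k+l_2,\mathbf{k})\\ &+\sum_{\substack{0\leqslant i\leqslant n_2\\ 0\leqslant j\leqslant \min\{m,n_2-i\}\\ \mathbf{k}\in A^{m+n_2-i-2j}_j}}\binom{m+n_2-i-2j}{m-j}\left[\zeta(l_1,\{p\}^{n_1},l_2,\{p\}^{i},k,\mathbf{k})+\zeta(l_1,\{p\}^{n_1},l_2,\{p\}^{i-1},p+k,\mathbf{k})\right]\\ &+\sum_{\substack{0\leqslant i\leqslant m\\ 0\leqslant j_1\leqslant \min\{i,n_1\}\\ 0\leqslant j_2\leqslant \min\{m-i,n_2\}\\ \mathbf{k}\in A^{n_1+i-2j_1}_{j_1}\\ \mathbf{l}\in A^{m+n_2-i-2j_2}_{j_2}}}\binom{n_1+i-2j_1}{n_1-j_1}\binom{m+n_2-i-2j_2}{n_2-j_2}\zeta(k+l_1,\mathbf{k},l_2,\mathbf{l})\\ &+\sum_{\substack{0\leqslant i\leqslant m\\ 0\leqslant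 j_1\leqslant \min\{i-1,n_1\}\\ 0\leqslant j_2\leqslant \min\{m-i,n_2\}\\ \mathbf{k}\in A^{n_1+i-2j_1-1}_{j_1}\\ \mathbf{l}\in A^{m+n_2-i-2j_2}_{j_2}}}\binom{n_1+i-2j_1-1}{n_1-j_1}\binom{m+n_2-i-2j_2}{n_2-j_2}\zeta(k+l_1,\mathbf{k},p+l_2,\mathbf{l}). \end{align*} (4) \begin{align*} &\zeta^{\star}(k,\{p\}^m)\zeta^{\star}(l_1,\{p\}^{n_1},l_2,\{p\}^{n_2})\\ =&\sum_{\substack{0\leqslant i_1\leqslant i_2\leqslant m\\ 0\leqslant j_1\leqslant \min\{i_2-i_1,n_1\}\\ 0\leqslant j_2\leqslant \min\{m-i_2,n_2\}\\ \mathbf{k}\in A^{n_1+i_2-i_1-2j_1}_{j_1}\\ \mathbf{l}\in A^{m+n_2-i_2-2j_2}_{j_2}}}(-1)^{j_1+j_2}\binom{n_1+i_2-i_1-2j_1}{n_1-j_1}\binom{m+n_2-i_2-2j_2}{n_2-j_2}\\ &\quad\times \left[\zeta^{\star}(k,\{p\}^{i_1},l_1,\mathbf{k},l_2,\mathbf{l})-\zeta^{\star}(k,\{p\}^{i_1-1},p+l_1,\mathbf{k},l_2,\mathbf{l})\right]\\ &-\sum_{\substack{0\leqslant i_1\leqslant i_2\leqslant m\\ 0\leqslant j_1\leqslant \min\{i_2-i_1-1,n_1\}\\ 0\leqslant j_2\leqslant \min\{m-i_2,n_2\}\\ \mathbf{k}\in A^{n_1+i_2-i_1-2j_1-1}_{j_1}\\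 \mathbf{l}\in A^{m+n_2-i_2-2j_2}_{j_2}}}(-1)^{j_1+j_2}\binom{n_1+i_2-i_1-2j_1-1}{n_1-j_1}\binom{m+n_2-i_2-2j_2}{n_2-j_2}\\ &\quad\times \left[\zeta^{\star}(k,\{p\}^{i_1},l_1,\mathbf{k},p+l_2,\mathbf{l})-\zeta^{\star}(k,\{p\}^{i_1-1},p+l_1,\mathbf{k},p+l_2,\mathbf{l})\right]\\ &+\sum_{\substack{0\leqslant i_1\leqslant n_1,\;0\leqslant i_2\leqslant m\\ 0\leqslant j_1\leqslant \min\{i_2,n_1-i_1\}\\ 0\leqslant j_2\leqslant \min\{m-i_2,n_2\}\\ \mathbf{k}\in A^{n_1+i_2-i_1-2j_1}_{j_1}\\ \mathbf{l}\in A^{m+n_2-i_2-2j_2}_{j_2}}}(-1)^{j_1+j_2}\binom{n_1+i_2-i_1-2j_1}{i_2-j_1}\binom{m+n_2-i_2-2j_2}{n_2-j_2}\\ &\quad\times\left[\zeta^{\star}(l_1,\{p\}^{i_1},k,\mathbf{k},l_2,\mathbf{l})-\zeta^{\star}(l_1,\{p\}^{i_1-1},p+k,\mathbf{k},l_2,\mathbf{l})\right]\\ &-\sum_{\substack{0\leqslant i_1\leqslant n_1,\;0\leqslant i_2\leqslant m\\ 0\leqslant j_1\leqslant \min\{i_2-1,n_1-i_1\}\\ 0\leqslant j_2\leqslant \min\{m-i_2,n_2\}\\ \mathbf{k}\in A^{n_1+i_2-i_1-2j_1-1}_{j_1}\\ \mathbf{l}\in A^{m+n_2-i_2-2j_2}_{j_2}}}(-1)^{j_1+j_2}\binom{n_1+i_2-i_1-2j_1-1}{i_2-j_1-1}\binom{m+n_2-i_2-2j_2}{n_2-j_2}\\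 &\quad\times\left[\zeta^{\star}(l_1,\{p\}^{i_1},k,\mathbf{k},p+l_2,\mathbf{l})-\zeta^{\star}(l_1,\{p\}^{i_1-1},p+k,\mathbf{k},p+l_2,\mathbf{l})\right]\\ &-\sum_{\substack{0\leqslant j\leqslant \min\{m,n_2\}\\ \mathbf{k}\in A^{m+n_2-2j}_j}}(-1)^{j}\binom{m+n_2-2j}{m-j}\zeta^{\star}(l_1,\{p\}^{n_1},k+l_2,\mathbf{k})\\ &+\sum_{\substack{0\leqslant i\leqslant n_2\\ 0\leqslant j\leqslant \min\{m,n_2-i\}\\ \mathbf{k}\in A^{m+n_2-i-2j}_j}}(-1)^{j}\binom{m+n_2-i-2j}{m-j}\left[\zeta^{\star}(l_1,\{p\}^{n_1},l_2,\{p\}^{i},k,\mathbf{k})-\zeta^{\star}(l_1,\{p\}^{n_1},l_2,\{p\}^{i-1},p+k,\mathbf{k})\right]\\ &-\sum_{\substack{0\leqslant i\leqslant m\\ 0\leqslant j_1\leqslant \min\{i,n_1\}\\ 0\leqslant j_2\leqslant \min\{m-i,n_2\}\\ \mathbf{k}\in A^{n_1+i-2j_1}_{j_1}\\ \mathbf{l}\in A^{m+n_2-i-2j_2}_{j_2}}}(-1)^{j_1+j_2}\binom{n_1+i-2j_1}{n_1-j_1}\binom{m+n_2-i-2j_2}{n_2-j_2}\zeta^{\star}(k+l_1,\mathbf{k},l_2,\mathbf{l})\\ &+\sum_{\substack{0\leqslant i\leqslant m\\ 0\leqslant j_1\leqslant \min\{i-1,n_1\}\\ 0\leqslant j_2\leqslant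 \min\{m-i,n_2\}\\ \mathbf{k}\in A^{n_1+i-2j_1-1}_{j_1}\\ \mathbf{l}\in A^{m+n_2-i-2j_2}_{j_2}}}(-1)^{j_1+j_2}\binom{n_1+i-2j_1-1}{n_1-j_1}\binom{m+n_2-i-2j_2}{n_2-j_2}\zeta^{\star}(k+l_1,\mathbf{k},p+l_2,\mathbf{l}). \end{align*} Here any zeta or zeta-star value whose argument contains $\{p\}^{-1}$ is set to be $0$.
   Context: For integers $k_1\geqslant 2$ and $k_2,\ldots,k_n\geqslant 1$, the multiple zeta value and the multiple zeta-star value are the real numbers $$\zeta(k_1,\ldots,k_n)=\sum_{m_1>m_2>\cdots>m_n>0}\frac{1}{m_1^{k_1}m_2^{k_2}\cdots m_n^{k_n}},\qquad \zeta^\star(k_1,\ldots,k_n)=\sum_{m_1\geqslant m_2\geqslant\cdots\geqslant m_n\geqslant 1}\frac{1}{m_1^{k_1}m_2^{k_2}\cdots m_n^{k_n}}.$$ For $m\geqslant 0$, $\{p\}^m$ stands for a string of $m$ copies of $p$ (the empty string if $m=0$). A string $\mathbf{k}$ (or $\mathbf{l}$) appearing inside an argument list is inserted as consecutive arguments; bold $\mathbf{k},\mathbf{l}$ are strings (finite sequences), not to be confused with the integers $k,l$. $A_b^a$ is the set of finite sequences of length $a+b$ with exactly $a$ entries equal to $p$ and exactly $b$ entries equal to $2p$. Sums over an empty index range (e.g. $0\leqslant j_1\leqslant -1$) are zero. *)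

theory Defs
  imports "HOL-Analysis.Analysis"
begin

text \<open>For an argument list with first entry at least 2 and the others at least 1 the series below have
  nonnegative terms and converge, so the unordered sums are the usual ones.\<close>

definition mzv :: "nat list \<Rightarrow> real" where
  "mzv ks = (\<Sum>\<^sub>\<infinity>ms\<in>{ms. length ms = length ks \<and> sorted_wrt (>) ms \<and> (\<forall>m\<in>set ms. 0 < m)}.
     1 / (\<Prod>i<length ks. real (ms ! i) ^ (ks ! i)))"

definition mzsv :: "nat list \<Rightarrow> real" where
  "mzsv ks = (\<Sum>\<^sub>\<infinity>ms\<in>{ms. length ms = length ks \<and> sorted_wrt (\<ge>) ms \<and> (\<forall>m\<in>set ms. 1 \<le> m)}.
     1 / (\<Prod>i<length ks. real (ms ! i) ^ (ks ! i)))"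

text \<open>\<open>pstrings p a b\<close> is $A^a_b$. For \<open>p > 0\<close> the entries \<open>p\<close> and \<open>2 * p\<close> differ, so the
  two counts already exhaust the length and no other entries occur.\<close>

definition pstrings :: "nat \<Rightarrow> nat \<Rightarrow> nat \<Rightarrow> nat list set" where
  "pstrings p a b =
     {ks. length ks = a + b \<and> count_list ks p = a \<and> count_list ks (2 * p) = b}"

end

theory Submission
  imports Defs "HOL-Real_Asymp.Real_Asymp"
begin

text \<open>Both kinds of series multiply by the stuffle rule.  In a product of two nested sums, compare the two
  largest summation indices: one is larger, or they coincide and their exponents add.  Recursively this
  expands the product into a signed sum over the words of a quasi-shuffle of the two argument lists, in
  which each merger of two letters contributes a factor \<open>t\<close>; it is \<open>t = 1\<close> for strict sums, and \<open>t = - 1\<close> for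
  weak sums, where the diagonal is counted twice and has to be subtracted once.  For truncated sums this
  is an induction (\<open>trunc_zeta_mult\<close>), which treats both cases at once; the truncated sums converge to
  the series because a first exponent of at least 2 beats the powers of harmonic numbers that bound the inner
  sums (\<open>trunc_zeta_tendsto\<close>).  This gives \<open>mzv_mult\<close> and \<open>mzsv_mult\<close>.

  What remains is combinatorics of words, uniform in \<open>t\<close> and in the function \<open>f\<close> that is evaluated at the
  words.  The quasi-shuffle of two constant strings consists of the strings in \<open>p\<close> and \<open>2 * p\<close> with binomial
  multiplicities (\<open>stuffle_replicate_replicate\<close>).  The quasi-shuffle with a word that has a distinguished
  letter is cut at this letter into two independent quasi-shuffles (\<open>stuffle_split\<close>).  Cutting
  the products of the theorem at the letters other than \<open>p\<close> reduces them to constant strings, and each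
  sum in the theorem collects the words in which these letters occur in a given order with given
  mergers.  The identities for zeta and zeta-star values are the cases \<open>t = 1\<close> and \<open>t = - 1\<close> of the same
  two expansions.\<close>

section \<open>The stuffle product\<close>

text \<open>This is the quasi-shuffle product of two words with merging parameter \<open>t\<close>, in dual form: instead of the
  formal linear combination of words, its value under the linear functional given by \<open>f\<close>.  In this form
  linear combinations of words need no representation, and prepending a letter to every word of the
  product is a composition on the side of \<open>f\<close>.\<close>
fun stuffle :: "'b::comm_ring_1 \<Rightarrow> ('a::ab_semigroup_add list \<Rightarrow> 'b) \<Rightarrow> 'a list \<Rightarrow> 'a list \<Rightarrow> 'b" where
  "stuffle t f [] v = f v"
| "stuffle t f (a # u) [] = f (a # u)"
| "stuffle t f (a # u) (b # v) =
     stuffle t (\<lambda>w. f (a # w)) u (b # v) + stuffle t (\<lambda>w. f (b # w)) (a # u) v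
     + t * stuffle t (\<lambda>w. f ((a + b) # w)) u v"

lemma stuffle_Nil_right [simp]: "stuffle t f u [] = f u"
  by (cases u) auto

lemma stuffle_commute: "stuffle t f u v = stuffle t f v u"
  by (induction t f u v rule: stuffle.induct) (simp_all add: add_ac)

lemma stuffle_add: "stuffle t (\<lambda>w. f w + g w) u v = stuffle t f u v + stuffle t g u v"
proof (induction t f u v arbitrary: g rule: stuffle.induct)
  case (3 t f a u b v)
  show ?case
    unfolding stuffle.simps 3 by (simp add: algebra_simps)
qed auto

lemma stuffle_scale: "stuffle t (\<lambda>w. c * f w) u v = c * stuffle t f u v"
  by (induction t f u v rule: stuffle.induct) (simp_all add: algebra_simps)

lemma stuffle_zero: "stuffle t (\<lambda>_. 0) u v = 0"
  using stuffle_scale[of t 0 "\<lambda>_. 0" u v] by simp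

text \<open>The letter \<open>l\<close> of the second word is either placed in one of the gaps of \<open>u\<close> or merged with a letter
  of \<open>u\<close>; either way what precedes it in \<open>u\<close> stays in front, and the rest of \<open>u\<close> is stuffled with \<open>v\<close>.\<close>
lemma stuffle_Cons_right:
  "stuffle t f u (l # v) =
     (\<Sum>i\<le>length u. stuffle t (\<lambda>y. f (take i u @ l # y)) (drop i u) v)
     + t * (\<Sum>i<length u. stuffle t (\<lambda>y. f (take i u @ (u ! i + l) # y)) (drop (Suc i) u) v)"
proof (induction u arbitrary: f)
  case Nil
  show ?case by simp
next
  case (Cons a u)
  show ?case
    using Cons[of "\<lambda>w. f (a # w)"]
    by (simp add: sum.atMost_Suc_shift sum.lessThan_Suc_shift algebra_simps
             del: sum.atMost_Suc sum.lessThan_Suc)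
qed

text \<open>More generally, a stuffle with a word that contains a distinguished letter \<open>l\<close> factors at \<open>l\<close>: the
  position of \<open>l\<close> relative to \<open>u\<close> cuts \<open>u\<close> into a part that is stuffled with what precedes \<open>l\<close> and a part
  that is stuffled with what follows it.  The two factors are expressed by nesting, since \<open>f\<close> need not be
  multiplicative under concatenation.\<close>
lemma stuffle_split:
  "stuffle t f u (v @ l # v') =
     (\<Sum>i\<le>length u. stuffle t (\<lambda>x. stuffle t (\<lambda>y. f (x @ l # y)) (drop i u) v') (take i u) v)
     + t * (\<Sum>i<length u. stuffle t (\<lambda>x. stuffle t (\<lambda>y. f (x @ (u ! i + l) # y)) (drop (Suc i) u) v')
              (take i u) v)"
proof (induction t f u v rule: stuffle.induct)
  case (1 t f v)
  show ?case by simp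
next
  case (2 t f a u)
  show ?case
    unfolding append_Nil stuffle_Cons_right[of t f "a # u"] by simp
next
  case (3 t f a u b v)
  show ?case using 3
    by (simp add: sum.atMost_Suc_shift sum.lessThan_Suc_shift sum.distrib sum_distrib_left algebra_simps
             del: sum.atMost_Suc sum.lessThan_Suc)
qed

section \<open>The product formula for truncated sums\<close>

text \<open>The parameter \<open>d\<close> is the least admissible difference of neighbouring summation indices: \<open>d = 1\<close> gives
  the truncation of a multiple zeta value at \<open>M\<close>, and \<open>d = 0\<close> that of a zeta-star value.\<close>
fun trunc_zeta :: "nat \<Rightarrow> nat \<Rightarrow> nat list \<Rightarrow> real" where
  "trunc_zeta d M [] = 1"
| "trunc_zeta d M (k # ks) = (\<Sum>m\<in>{1..M}. 1 / real m ^ k * trunc_zeta d (m - d) ks)"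

text \<open>Write \<open>A\<close>, \<open>B\<close> for the two sums at \<open>M\<close>, \<open>A'\<close>, \<open>B'\<close> for those at \<open>M - 1\<close>, and \<open>x\<close>, \<open>y\<close> for the terms with
  largest index \<open>M\<close>, so that \<open>A = A' + x\<close> and \<open>B = B' + y\<close>.  For strict sums \<open>x\<close> contains a sum truncated at
  \<open>M - 1\<close>, which pairs with \<open>B'\<close>, and \<open>A B = A' B' + x B' + A' y + x y\<close>.  For weak sums it pairs with the full
  \<open>B\<close>, and \<open>A B = A' B' + x B + A y - x y\<close>.  These are the two recursions of the stuffle product, with
  merging parameter 1 and -1.\<close>
lemma trunc_zeta_mult:
  assumes "d \<le> 1"
  shows "trunc_zeta d M u * trunc_zeta d M v = stuffle (2 * real d - 1) (trunc_zeta d M) u v"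
proof (induction "M + length u + length v" arbitrary: M u v rule: less_induct)
  case less
  show ?case
  proof (cases "u = [] \<or> v = []")
    case True
    then show ?thesis by auto
  next
    case False
    then obtain a u' b v' where uv: "u = a # u'" "v = b # v'"
      by (meson neq_Nil_conv)
    define t :: real where "t = 2 * real d - 1"
    show ?thesis
    proof (cases M)
      case 0
      \<comment> \<open>The zeros are written as multiples of zero, for the linearity of the stuffle in the function.\<close>
      have "stuffle t (trunc_zeta d 0) (a # u') (b # v') = stuffle t (\<lambda>w. 0 * 0) u' (b # v')
         + stuffle t (\<lambda>w. 0 * 0) (a # u') v' + t * stuffle t (\<lambda>w. 0 * 0) u' v'"
        by simp
      also have "\<dots> = 0"
        by (simp only: stuffle_scale)
      finally show ?thesis using 0 uv by (simp add: t_def)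
    next
      case (Suc N)
      define x where "x k = 1 / real M ^ k" for k :: nat
      have x: "x (a + b) = x a * x b"
        by (simp add: x_def power_add)
      have step: "trunc_zeta d M (k # w) = trunc_zeta d N (k # w) + x k * trunc_zeta d (M - d) w" for k w
        by (simp add: Suc x_def)
      have IH1: "trunc_zeta d N (a # u') * trunc_zeta d N (b # v') = stuffle t (trunc_zeta d N) (a # u') (b # v')"
        using less[of N "a # u'" "b # v'"] by (simp add: Suc uv t_def)
      have IH2: "trunc_zeta d (M - d) u' * trunc_zeta d (M - d) (b # v') = stuffle t (trunc_zeta d (M - d)) u' (b # v')"
        using less[of "M - d" u' "b # v'"] by (simp add: uv t_def)
      have IH3: "trunc_zeta d (M - d) (a # u') * trunc_zeta d (M - d) v' = stuffle t (trunc_zeta d (M - d)) (a # u') v'"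
        using less[of "M - d" "a # u'" v'] by (simp add: uv t_def)
      have IH4: "trunc_zeta d (M - d) u' * trunc_zeta d (M - d) v' = stuffle t (trunc_zeta d (M - d)) u' v'"
        using less[of "M - d" u' v'] by (simp add: uv t_def)
      have "stuffle t (trunc_zeta d M) u v = stuffle t (trunc_zeta d N) (a # u') (b # v')
          + x a * stuffle t (trunc_zeta d (M - d)) u' (b # v')
          + x b * stuffle t (trunc_zeta d (M - d)) (a # u') v'
          + t * (x a * x b) * stuffle t (trunc_zeta d (M - d)) u' v'"
        unfolding uv stuffle.simps step stuffle_add stuffle_scale x
        by (simp only: algebra_simps)
      also have "\<dots> = trunc_zeta d N (a # u') * trunc_zeta d N (b # v')
          + x a * (trunc_zeta d (M - d) u' * trunc_zeta d (M - d) (b # v'))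
          + x b * (trunc_zeta d (M - d) (a # u') * trunc_zeta d (M - d) v')
          + t * (x a * x b) * (trunc_zeta d (M - d) u' * trunc_zeta d (M - d) v')"
        by (simp only: IH1 IH2 IH3 IH4)
      also have "\<dots> = trunc_zeta d M u * trunc_zeta d M v"
      proof (cases "d = 0")
        case True
        then show ?thesis
          unfolding uv t_def step[of a] step[of b] using step[of a u'] step[of b v']
          by (simp del: trunc_zeta.simps add: algebra_simps)
      next
        case False
        with assms have "d = 1" by simp
        then show ?thesis
          unfolding uv t_def step[of a] step[of b]
          by (simp del: trunc_zeta.simps add: Suc algebra_simps)
      qed
      finally show ?thesis by (simp add: t_def)
    qed
  qed
qed

section \<open>Passing to the limit\<close>

text \<open>A stuffle is a finite linear combination of values of \<open>f\<close>, so pointwise limits pass through it; merging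
  adds letters and therefore keeps them positive.\<close>
lemma tendsto_stuffle:
  assumes "\<And>w. list_all (\<lambda>k. k > 0) w \<Longrightarrow> ((\<lambda>x. F x w) \<longlongrightarrow> f w) G"
    and "list_all (\<lambda>k. k > 0) u" "list_all (\<lambda>k. k > (0::nat)) v"
  shows "((\<lambda>x. stuffle t (F x) u v) \<longlongrightarrow> stuffle (t::real) f u v) G"
  using assms
proof (induction t f u v arbitrary: F rule: stuffle.induct)
  case (3 t f a u b v)
  show ?case unfolding stuffle.simps
    using 3(5,6) by (intro tendsto_intros 3(1-3)) (auto intro!: 3(4))
qed auto

lemma trunc_zeta_nonneg: "trunc_zeta d M ks \<ge> 0"
  by (induction ks arbitrary: M) (auto intro!: sum_nonneg)

text \<open>Dropping all order conditions except the bound \<open>M\<close> on the indices, and lowering all exponents to 1,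
  leaves a power of the harmonic number.\<close>
lemma trunc_zeta_le_harm:
  assumes "list_all (\<lambda>k. k > 0) ks"
  shows "trunc_zeta d M ks \<le> harm M ^ length ks"
  using assms
proof (induction ks arbitrary: M)
  case (Cons k ks)
  have "trunc_zeta d M (k # ks) \<le> (\<Sum>m\<in>{1..M}. inverse (real m) * harm M ^ length ks)"
    unfolding trunc_zeta.simps
  proof (intro sum_mono mult_mono)
    fix m assume m: "m \<in> {1..M}"
    show "1 / real m ^ k \<le> inverse (real m)"
      using m Cons.prems by (auto simp: field_simps intro: self_le_power)
    have "trunc_zeta d (m - d) ks \<le> harm (m - d) ^ length ks"
      using Cons by simp
    also have "\<dots> \<le> harm M ^ length ks"
      using m by (intro power_mono harm_nonneg harm_mono) auto
    finally show "trunc_zeta d (m - d) ks \<le> harm M ^ length ks" .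
  qed (auto simp: trunc_zeta_nonneg)
  also have "\<dots> = harm M ^ length (k # ks)"
    by (simp add: harm_def sum_distrib_right)
  finally show ?case .
qed simp

lemma summable_harm_power: "summable (\<lambda>m. harm m ^ r / real m ^ 2 :: real)"
proof (rule summable_comparison_test_bigo)
  \<comment> \<open>Any exponent strictly between -2 and -1 leaves room for the logarithms.\<close>
  show "summable (\<lambda>m. norm (real m powr (-3/2)))"
    by (simp add: summable_real_powr_iff)
  have "(\<lambda>m. harm m ^ r / real m ^ 2 :: real) \<in> O(\<lambda>m. (ln (real m) + 1) ^ r / real m ^ 2)"
  proof (intro bigoI[where c = 1] eventually_mono[OF eventually_gt_at_top[of 0]])
    fix m :: nat assume m: "m > 0"
    have "harm m - ln (real m) \<le> 1"
      using euler_mascheroni_sequence_decreasing[of 1 m] m by (simp add: harm_def)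
    then have "harm m ^ r \<le> \<bar>ln (real m) + 1\<bar> ^ r"
      using harm_nonneg[of m, where 'a = real] by (intro power_mono) auto
    then show "norm (harm m ^ r / real m ^ 2 :: real) \<le> 1 * norm ((ln (real m) + 1) ^ r / real m ^ 2)"
      by (simp add: power_abs divide_right_mono harm_nonneg)
  qed
  also have "(\<lambda>m. (ln (real m) + 1) ^ r / real m ^ 2) \<in> O(\<lambda>m. real m powr (-3/2))"
    by real_asymp
  finally show "(\<lambda>m. harm m ^ r / real m ^ 2 :: real) \<in> O(\<lambda>m. real m powr (-3/2))" .
qed

lemma trunc_zeta_bounded:
  assumes "k \<ge> 2" "list_all (\<lambda>k. k > 0) ks"
  shows "\<exists>B. \<forall>M. trunc_zeta d M (k # ks) \<le> B"
proof (intro exI allI)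
  fix M
  have "trunc_zeta d M (k # ks) \<le> (\<Sum>m\<in>{1..M}. harm m ^ length ks / real m ^ 2)"
    unfolding trunc_zeta.simps
  proof (intro sum_mono)
    fix m assume m: "m \<in> {1..M}"
    have "1 / real m ^ k * trunc_zeta d (m - d) ks \<le> 1 / real m ^ 2 * harm m ^ length ks"
    proof (intro mult_mono)
      show "1 / real m ^ k \<le> 1 / real m ^ 2"
        using m assms(1) by (intro divide_left_mono power_increasing) auto
      have "trunc_zeta d (m - d) ks \<le> harm (m - d) ^ length ks"
        by (rule trunc_zeta_le_harm) fact
      also have "\<dots> \<le> harm m ^ length ks"
        by (intro power_mono harm_nonneg harm_mono) auto
      finally show "trunc_zeta d (m - d) ks \<le> harm m ^ length ks" .
    qed (auto simp: trunc_zeta_nonneg)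
    then show "1 / real m ^ k * trunc_zeta d (m - d) ks \<le> harm m ^ length ks / real m ^ 2"
      by simp
  qed
  also have "\<dots> \<le> (\<Sum>m. harm m ^ length ks / real m ^ 2)"
    by (intro sum_le_suminf summable_harm_power) (auto simp: harm_nonneg)
  finally show "trunc_zeta d M (k # ks) \<le> (\<Sum>m. harm m ^ length ks / real m ^ 2)" .
qed

text \<open>The index sets of the strict (\<open>d = 1\<close>) and weak (\<open>d = 0\<close>) series.\<close>
definition gapped_lists :: "nat \<Rightarrow> nat \<Rightarrow> nat list set" where
  "gapped_lists d n = {ms. length ms = n \<and> sorted_wrt (\<lambda>x y. y + d \<le> x) ms \<and> (\<forall>m\<in>set ms. 1 \<le> m)}"

definition gapped_lists_upto :: "nat \<Rightarrow> nat \<Rightarrow> nat \<Rightarrow> nat list set" where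
  "gapped_lists_upto d n M = {ms \<in> gapped_lists d n. \<forall>m\<in>set ms. m \<le> M}"

lemma finite_gapped_lists_upto: "finite (gapped_lists_upto d n M)"
  by (rule finite_subset[OF _ finite_lists_length_eq[of "{..M}" n]])
     (auto simp: gapped_lists_upto_def gapped_lists_def)

lemma gapped_lists_upto_Suc:
  "gapped_lists_upto d (Suc n) M = (\<lambda>(m, ms). m # ms) ` (SIGMA m:{1..M}. gapped_lists_upto d n (m - d))"
proof (intro set_eqI iffI)
  fix ms assume "ms \<in> gapped_lists_upto d (Suc n) M"
  then show "ms \<in> (\<lambda>(m, ms). m # ms) ` (SIGMA m:{1..M}. gapped_lists_upto d n (m - d))"
    by (cases ms) (force simp: gapped_lists_upto_def gapped_lists_def)+
next
  fix ms assume "ms \<in> (\<lambda>(m, ms). m # ms) ` (SIGMA m:{1..M}. gapped_lists_upto d n (m - d))"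
  then obtain m ms' where *: "ms = m # ms'" "m \<in> {1..M}" "ms' \<in> gapped_lists_upto d n (m - d)"
    by auto
  have "y + d \<le> m" if "y \<in> set ms'" for y
  proof -
    have "1 \<le> y" "y \<le> m - d" using * that by (auto simp: gapped_lists_upto_def gapped_lists_def)
    then show ?thesis by linarith
  qed
  moreover have "y \<le> M" if "y \<in> set ms'" for y
    using calculation[OF that] * by simp
  ultimately show "ms \<in> gapped_lists_upto d (Suc n) M"
    using * by (auto simp: gapped_lists_upto_def gapped_lists_def)
qed

lemma trunc_zeta_eq_sum_gapped_lists:
  "trunc_zeta d M ks = (\<Sum>ms\<in>gapped_lists_upto d (length ks) M. 1 / (\<Prod>i<length ks. real (ms ! i) ^ (ks ! i)))"
proof (induction ks arbitrary: M)
  case Nil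
  have "gapped_lists_upto d 0 M = {[]}"
    by (auto simp: gapped_lists_upto_def gapped_lists_def)
  then show ?case by simp
next
  case (Cons k ks)
  have inj: "inj_on (\<lambda>(m, ms). m # ms) A" for A :: "(nat \<times> nat list) set"
    by (auto simp: inj_on_def)
  have "(\<Sum>ms\<in>gapped_lists_upto d (length (k # ks)) M. 1 / (\<Prod>i<length (k # ks). real (ms ! i) ^ ((k # ks) ! i)))
      = (\<Sum>(m, ms)\<in>(SIGMA m:{1..M}. gapped_lists_upto d (length ks) (m - d)).
           1 / real m ^ k * (1 / (\<Prod>i<length ks. real (ms ! i) ^ (ks ! i))))"
    unfolding list.size gapped_lists_upto_Suc add_Suc_right add_0_right sum.reindex[OF inj]
    by (intro sum.cong) (auto simp: prod.lessThan_Suc_shift simp del: prod.lessThan_Suc)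
  also have "\<dots> = trunc_zeta d M (k # ks)"
    by (simp add: Cons.IH sum.Sigma finite_gapped_lists_upto sum_distrib_left)
  finally show ?case ..
qed

text \<open>The truncated index sets are finite and exhaust the index set, so they are cofinal among its finite
  subsets; hence once the series is known to be summable, the truncated sums converge to its unordered sum.\<close>
lemma trunc_zeta_tendsto:
  assumes "k \<ge> 2" "list_all (\<lambda>k. k > 0) ks"
  shows "(\<lambda>M. trunc_zeta d M (k # ks)) \<longlonglongrightarrow>
    (\<Sum>\<^sub>\<infinity>ms\<in>gapped_lists d (length (k # ks)). 1 / (\<Prod>i<length (k # ks). real (ms ! i) ^ ((k # ks) ! i)))"
proof -
  define n where "n = length (k # ks)"
  define f where "f ms = 1 / (\<Prod>i<n. real (ms ! i) ^ ((k # ks) ! i))" for ms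
  have partial: "trunc_zeta d M (k # ks) = sum f (gapped_lists_upto d n M)" for M
    unfolding trunc_zeta_eq_sum_gapped_lists f_def n_def ..
  have f: "f ms \<ge> 0" for ms
    by (simp add: f_def prod_nonneg)
  have sub: "\<exists>M. X \<subseteq> gapped_lists_upto d n M" if X: "finite X" "X \<subseteq> gapped_lists d n" for X
  proof (intro exI subsetI)
    fix ms assume ms: "ms \<in> X"
    have "m \<le> Max (\<Union>ms\<in>X. set ms)" if "m \<in> set ms" for m
      using X(1) ms that by (intro Max_ge) auto
    then show "ms \<in> gapped_lists_upto d n (Max (\<Union>ms\<in>X. set ms))"
      using X ms by (auto simp: gapped_lists_upto_def)
  qed
  obtain B where B: "trunc_zeta d M (k # ks) \<le> B" for M
    using trunc_zeta_bounded[OF assms] by blast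
  have "f summable_on gapped_lists d n"
  proof (rule nonneg_bounded_partial_sums_imp_summable_on[where C = B])
    show "\<forall>\<^sub>F F in finite_subsets_at_top (gapped_lists d n). sum f F \<le> B"
    proof (rule eventually_finite_subsets_at_top_weakI)
      fix X assume "finite X" "X \<subseteq> gapped_lists d n"
      then obtain M where "X \<subseteq> gapped_lists_upto d n M" using sub by blast
      then have "sum f X \<le> sum f (gapped_lists_upto d n M)"
        using f by (intro sum_mono2 finite_gapped_lists_upto)
      with B[of M] show "sum f X \<le> B" by (simp add: partial del: trunc_zeta.simps)
    qed
  qed (use f in auto)
  then have lim: "(sum f \<longlongrightarrow> infsum f (gapped_lists d n)) (finite_subsets_at_top (gapped_lists d n))"
    using has_sum_infsum has_sum_def by blast
  have "filterlim (gapped_lists_upto d n) (finite_subsets_at_top (gapped_lists d n)) sequentially"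
    unfolding filterlim_finite_subsets_at_top
  proof (intro allI impI)
    fix X assume "finite X \<and> X \<subseteq> gapped_lists d n"
    then obtain M where M: "X \<subseteq> gapped_lists_upto d n M" using sub by blast
    have "X \<subseteq> gapped_lists_upto d n N" if "N \<ge> M" for N
      using M that by (fastforce simp: gapped_lists_upto_def)
    then show "\<forall>\<^sub>F N in sequentially. finite (gapped_lists_upto d n N) \<and> X \<subseteq> gapped_lists_upto d n N
                 \<and> gapped_lists_upto d n N \<subseteq> gapped_lists d n"
      unfolding eventually_sequentially using finite_gapped_lists_upto by (auto simp: gapped_lists_upto_def)
  qed
  from filterlim_compose[OF lim this]
  show ?thesis
    unfolding partial n_def[symmetric] by (simp only: f_def[abs_def] o_def)
qed

text \<open>Positive later exponents keep the inner sums below powers of harmonic numbers, and a first exponent of at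
  least 2 absorbs these, so the series with such an argument list converge.\<close>
definition admissible :: "nat list \<Rightarrow> bool" where
  "admissible ks \<longleftrightarrow> (\<exists>k ks'. ks = k # ks' \<and> k \<ge> 2 \<and> list_all (\<lambda>k. k > 0) ks')"

lemma trunc_zeta_tendsto_mzv: "admissible ks \<Longrightarrow> (\<lambda>M. trunc_zeta 1 M ks) \<longlonglongrightarrow> mzv ks"
  using trunc_zeta_tendsto[where d = 1]
  by (auto simp: admissible_def mzv_def gapped_lists_def Suc_le_eq simp del: trunc_zeta.simps)

lemma trunc_zeta_tendsto_mzsv: "admissible ks \<Longrightarrow> (\<lambda>M. trunc_zeta 0 M ks) \<longlonglongrightarrow> mzsv ks"
  using trunc_zeta_tendsto[where d = 0]
  by (auto simp: admissible_def mzsv_def gapped_lists_def simp del: trunc_zeta.simps)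

text \<open>After the first letter the stuffle only sees positive letters, and the first letter of each word of the
  product is one of the two first letters or their sum, hence at least 2.\<close>
lemma tendsto_stuffle_admissible:
  fixes F :: "'c \<Rightarrow> nat list \<Rightarrow> real"
  assumes F: "\<And>w. admissible w \<Longrightarrow> ((\<lambda>x. F x w) \<longlongrightarrow> f w) G" and uv: "admissible u" "admissible v"
  shows "((\<lambda>x. stuffle t (F x) u v) \<longlongrightarrow> stuffle t f u v) G"
proof -
  obtain a u' b v' where *: "u = a # u'" "v = b # v'" "a \<ge> 2" "b \<ge> 2"
      "list_all (\<lambda>k. k > 0) u'" "list_all (\<lambda>k. k > 0) v'"
    using uv unfolding admissible_def by blast
  show ?thesis
    unfolding *(1,2) stuffle.simps using *(3-6)
    by (intro tendsto_intros tendsto_stuffle F) (auto simp: admissible_def)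
qed

lemma mzv_mult:
  assumes "admissible u" "admissible v"
  shows "mzv u * mzv v = stuffle 1 mzv u v"
proof (rule LIMSEQ_unique)
  show "(\<lambda>M. trunc_zeta 1 M u * trunc_zeta 1 M v) \<longlonglongrightarrow> mzv u * mzv v"
    using assms by (intro tendsto_mult trunc_zeta_tendsto_mzv)
  show "(\<lambda>M. trunc_zeta 1 M u * trunc_zeta 1 M v) \<longlonglongrightarrow> stuffle 1 mzv u v"
    using tendsto_stuffle_admissible[OF trunc_zeta_tendsto_mzv assms, where t = 1] by (simp add: trunc_zeta_mult)
qed

lemma mzsv_mult:
  assumes "admissible u" "admissible v"
  shows "mzsv u * mzsv v = stuffle (-1) mzsv u v"
proof (rule LIMSEQ_unique)
  show "(\<lambda>M. trunc_zeta 0 M u * trunc_zeta 0 M v) \<longlonglongrightarrow> mzsv u * mzsv v"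
    using assms by (intro tendsto_mult trunc_zeta_tendsto_mzsv)
  show "(\<lambda>M. trunc_zeta 0 M u * trunc_zeta 0 M v) \<longlonglongrightarrow> stuffle (-1) mzsv u v"
    using tendsto_stuffle_admissible[OF trunc_zeta_tendsto_mzsv assms, where t = "-1"] by (simp add: trunc_zeta_mult)
qed

section \<open>Stuffles of constant strings\<close>

lemma count_list_add_le_length: "x \<noteq> y \<Longrightarrow> count_list ks x + count_list ks y \<le> length ks"
  by (induction ks) auto

lemma pstrings_0_0 [simp]: "pstrings p 0 0 = {[]}"
  by (auto simp: pstrings_def)

text \<open>A letter other than \<open>p\<close> and \<open>2 * p\<close> would make the string longer than the two counts allow.\<close>
lemma pstrings_Cons_iff:
  assumes "p > 0"
  shows "k # ks \<in> pstrings p a b \<longleftrightarrow>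
    (\<exists>a'. a = Suc a' \<and> k = p \<and> ks \<in> pstrings p a' b) \<or> (\<exists>b'. b = Suc b' \<and> k = 2 * p \<and> ks \<in> pstrings p a b')"
proof -
  have "count_list ks p + count_list ks (2 * p) \<le> length ks"
    using assms by (intro count_list_add_le_length) auto
  then show ?thesis using assms
    by (cases a; cases b) (auto simp: pstrings_def)
qed

lemma pstrings_rec:
  assumes "p > 0"
  shows "pstrings p (Suc a) 0 = (#) p ` pstrings p a 0"
    and "pstrings p 0 (Suc b) = (#) (2 * p) ` pstrings p 0 b"
    and "pstrings p (Suc a) (Suc b) = (#) p ` pstrings p a (Suc b) \<union> (#) (2 * p) ` pstrings p (Suc a) b"
proof -
  have ne: "[] \<notin> pstrings p a b" if "a + b > 0" for a b
    using that by (auto simp: pstrings_def)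
  have eqI: "A = B" if "[] \<notin> A" "[] \<notin> B" "\<And>k ks. k # ks \<in> A \<longleftrightarrow> k # ks \<in> B" for A B :: "nat list set"
  proof (intro set_eqI)
    fix ks show "ks \<in> A \<longleftrightarrow> ks \<in> B" using that by (cases ks) auto
  qed
  show "pstrings p (Suc a) 0 = (#) p ` pstrings p a 0"
    by (rule eqI) (auto simp: ne pstrings_Cons_iff assms)
  show "pstrings p 0 (Suc b) = (#) (2 * p) ` pstrings p 0 b"
    by (rule eqI) (auto simp: ne pstrings_Cons_iff assms)
  show "pstrings p (Suc a) (Suc b) = (#) p ` pstrings p a (Suc b) \<union> (#) (2 * p) ` pstrings p (Suc a) b"
    by (rule eqI) (auto simp: ne pstrings_Cons_iff assms)
qed

lemma finite_pstrings:
  assumes "p > 0"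
  shows "finite (pstrings p a b)"
proof (induction a arbitrary: b)
  case 0
  show ?case by (induction b) (auto simp: pstrings_rec assms)
next
  case (Suc a)
  then show ?case by (induction b) (auto simp: pstrings_rec assms)
qed

lemma sum_pstrings_rec:
  assumes "p > 0"
  shows "(\<Sum>ks\<in>pstrings p (Suc a) 0. f ks) = (\<Sum>ks\<in>pstrings p a 0. f (p # ks))"
    and "(\<Sum>ks\<in>pstrings p 0 (Suc b). f ks) = (\<Sum>ks\<in>pstrings p 0 b. f (2 * p # ks))"
    and "(\<Sum>ks\<in>pstrings p (Suc a) (Suc b). f ks) =
           (\<Sum>ks\<in>pstrings p a (Suc b). f (p # ks)) + (\<Sum>ks\<in>pstrings p (Suc a) b. f (2 * p # ks))"
proof -
  have "(#) p ` A \<inter> (#) (2 * p) ` B = {}" for A B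
    using assms by auto
  then show "(\<Sum>ks\<in>pstrings p (Suc a) (Suc b). f ks) =
           (\<Sum>ks\<in>pstrings p a (Suc b). f (p # ks)) + (\<Sum>ks\<in>pstrings p (Suc a) b. f (2 * p # ks))"
    using assms by (simp add: pstrings_rec sum.union_disjoint finite_pstrings sum.reindex)
qed (use assms in \<open>simp_all add: pstrings_rec sum.reindex\<close>)

text \<open>The explicit zero outside the range of \<open>j\<close> is needed for the recursion: truncated subtraction alone would
  give the binomial coefficient the value 1 at \<open>n - j = 0\<close> for \<open>j > n\<close>.\<close>
definition stuffle_coeff :: "nat \<Rightarrow> nat \<Rightarrow> nat \<Rightarrow> nat" where
  "stuffle_coeff m n j = (if j \<le> m \<and> j \<le> n then (m + n - 2 * j) choose (n - j) else 0)"

text \<open>A word with \<open>j\<close> letters \<open>2 * p\<close> that begins with \<open>p\<close> took this letter from one of the two factors, and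
  Pascal's rule adds the two counts; if it begins with \<open>2 * p\<close>, both factors lose a letter and \<open>j\<close> drops by
  one.  For \<open>j = Suc m\<close> or \<open>j = Suc n\<close> every letter of one factor is merged, and the words with a
  first letter \<open>p\<close> from that factor are missing.\<close>
lemma stuffle_coeff_sum_rec:
  fixes f :: "nat list \<Rightarrow> 'b::comm_ring_1"
  assumes "p > 0"
  defines "S \<equiv> \<lambda>m n j f. of_nat (stuffle_coeff m n j) * (\<Sum>ks\<in>pstrings p (m + n - 2 * j) j. f ks) :: 'b"
  shows "S (Suc m) (Suc n) j f =
    S m (Suc n) j (\<lambda>w. f (p # w)) + S (Suc m) n j (\<lambda>w. f (p # w))
    + (if j = 0 then 0 else S m n (j - 1) (\<lambda>w. f (2 * p # w)))"
proof -
  note rec = sum_pstrings_rec[OF assms(1)]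
  consider "j \<le> m" "j \<le> n" | "j = Suc m" "j \<le> n" | "j \<le> m" "j = Suc n" | "j = Suc m" "j = Suc n"
    | "j > Suc m \<or> j > Suc n" by linarith
  then show ?thesis
  proof cases
    case 1
    then obtain m' n' where mn: "m = j + m'" "n = j + n'"
      using le_Suc_ex by metis
    show ?thesis
      by (cases j) (simp_all add: S_def mn stuffle_coeff_def rec algebra_simps)
  next
    case 2
    then obtain n' where mn: "n = j + n'"
      using le_Suc_ex by metis
    show ?thesis
      using 2(1) by (simp add: S_def mn stuffle_coeff_def rec algebra_simps)
  next
    case 3
    then obtain m' where mn: "m = j + m'"
      using le_Suc_ex by metis
    show ?thesis
      using 3(2) by (simp add: S_def mn stuffle_coeff_def rec algebra_simps)
  next
    case 4
    then show ?thesis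
      by (simp add: S_def stuffle_coeff_def rec)
  next
    case 5
    then show ?thesis
      by (auto simp: S_def stuffle_coeff_def)
  qed
qed

lemma pstrings_replicate: "p > 0 \<Longrightarrow> pstrings p n 0 = {replicate n p}"
  by (induction n) (simp_all add: pstrings_rec)

text \<open>The sum runs to an arbitrary bound \<open>N\<close>, beyond which the coefficients vanish, so that the
  products of shorter strings in the recursion can be expanded over the range of the longer one.\<close>
lemma stuffle_replicate_eq_sum_atMost:
  fixes f :: "nat list \<Rightarrow> 'b::comm_ring_1"
  assumes "p > 0"
  shows "N \<ge> m + n \<Longrightarrow> stuffle t f (replicate m p) (replicate n p) =
    (\<Sum>j\<le>N. t ^ j * (of_nat (stuffle_coeff m n j) * (\<Sum>ks\<in>pstrings p (m + n - 2 * j) j. f ks)))"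
proof (induction "m + n" arbitrary: m n f N rule: less_induct)
  case less
  have single: "(\<Sum>j\<le>N. if j = 0 then c else 0) = (c :: 'b)" for c
    by simp
  consider "m = 0" | "n = 0" | m' n' where "m = Suc m'" "n = Suc n'"
    by (metis not0_implies_Suc)
  then show ?case
  proof cases
    case 1
    have "t ^ j * (of_nat (stuffle_coeff 0 n j) * (\<Sum>ks\<in>pstrings p (0 + n - 2 * j) j. f ks))
        = (if j = 0 then f (replicate n p) else 0)" for j
      by (simp add: stuffle_coeff_def pstrings_replicate assms)
    then show ?thesis by (simp add: 1)
  next
    case 2
    have "t ^ j * (of_nat (stuffle_coeff m 0 j) * (\<Sum>ks\<in>pstrings p (m + 0 - 2 * j) j. f ks))
        = (if j = 0 then f (replicate m p) else 0)" for j
      by (simp add: stuffle_coeff_def pstrings_replicate assms)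
    then show ?thesis by (simp only: 2 single) simp
  next
    case 3
    define S where "S = (\<lambda>m n j f. of_nat (stuffle_coeff m n j) * (\<Sum>ks\<in>pstrings p (m + n - 2 * j) j. f ks) :: 'b)"
    obtain N' where N: "N = Suc N'" "N' \<ge> m' + n'"
      using less.prems 3 by (cases N) auto
    have "(\<Sum>j\<le>N. t ^ j * S m n j f) = (\<Sum>j\<le>N. t ^ j * S m' n j (\<lambda>w. f (p # w)))
       + (\<Sum>j\<le>N. t ^ j * S m n' j (\<lambda>w. f (p # w)))
       + (\<Sum>j\<le>N. t ^ j * (if j = 0 then 0 else S m' n' (j - 1) (\<lambda>w. f (2 * p # w))))"
      unfolding 3 S_def stuffle_coeff_sum_rec[OF assms]
      by (simp only: distrib_left sum.distrib)
    also have "(\<Sum>j\<le>N. t ^ j * S m' n j (\<lambda>w. f (p # w)))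
        = stuffle t (\<lambda>w. f (p # w)) (replicate m' p) (replicate n p)"
      unfolding S_def using less.prems 3 by (intro less.hyps[symmetric]) auto
    also have "(\<Sum>j\<le>N. t ^ j * S m n' j (\<lambda>w. f (p # w)))
        = stuffle t (\<lambda>w. f (p # w)) (replicate m p) (replicate n' p)"
      unfolding S_def using less.prems 3 by (intro less.hyps[symmetric]) auto
    also have "(\<Sum>j\<le>N. t ^ j * (if j = 0 then 0 else S m' n' (j - 1) (\<lambda>w. f (2 * p # w))))
        = t * (\<Sum>j\<le>N'. t ^ j * S m' n' j (\<lambda>w. f (2 * p # w)))"
      by (simp add: N(1) sum.atMost_Suc_shift sum_distrib_left mult.assoc del: sum.atMost_Suc)
    also have "(\<Sum>j\<le>N'. t ^ j * S m' n' j (\<lambda>w. f (2 * p # w)))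
        = stuffle t (\<lambda>w. f (2 * p # w)) (replicate m' p) (replicate n' p)"
      unfolding S_def using N(2) 3 by (intro less.hyps[symmetric]) auto
    finally show ?thesis
      by (simp add: 3 S_def mult_2)
  qed
qed

text \<open>A word with \<open>j\<close> letters \<open>2 * p\<close> arises by choosing which of its \<open>m + n - 2 * j\<close> letters \<open>p\<close> come from the
  second factor, each letter \<open>2 * p\<close> being a merger and contributing \<open>t\<close>.\<close>
lemma stuffle_replicate_replicate:
  fixes f :: "nat list \<Rightarrow> 'b::comm_ring_1"
  assumes "p > 0"
  shows "stuffle t f (replicate m p) (replicate n p) =
    (\<Sum>j\<in>{0..min m n}. \<Sum>ks\<in>pstrings p (m + n - 2 * j) j.
       t ^ j * of_nat (m + n - 2 * j choose (n - j)) * f ks)"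
proof -
  have "stuffle t f (replicate m p) (replicate n p) =
    (\<Sum>j\<le>m + n. t ^ j * (of_nat (stuffle_coeff m n j) * (\<Sum>ks\<in>pstrings p (m + n - 2 * j) j. f ks)))"
    by (rule stuffle_replicate_eq_sum_atMost[OF assms]) simp
  also have "\<dots> = (\<Sum>j\<in>{0..min m n}. t ^ j * (of_nat (stuffle_coeff m n j) * (\<Sum>ks\<in>pstrings p (m + n - 2 * j) j. f ks)))"
    by (intro sum.mono_neutral_right) (auto simp: stuffle_coeff_def)
  also have "\<dots> = (\<Sum>j\<in>{0..min m n}. \<Sum>ks\<in>pstrings p (m + n - 2 * j) j.
       t ^ j * of_nat (m + n - 2 * j choose (n - j)) * f ks)"
    by (intro sum.cong) (auto simp: stuffle_coeff_def sum_distrib_left mult.assoc)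
  finally show ?thesis .
qed

section \<open>Inserting a letter into a string\<close>

text \<open>Merging with the \<open>i\<close>-th letter of a constant string leaves the same remainder as insertion in the \<open>i\<close>-th
  gap, so the two kinds of terms combine under one sum; no merger belongs to the gap in front.\<close>
lemma sum_stuffle_insert_merge:
  "(\<Sum>i\<le>m. stuffle t (f i) (u i) v) + t * (\<Sum>i<m. stuffle t (g (Suc i)) (u (Suc i)) v) =
   (\<Sum>i\<in>{0..m}. stuffle t (\<lambda>y. f i y + t * (if i = 0 then 0 else g i y)) (u i) v)"
proof -
  define h where "h i y = (if i = 0 then 0 else g i y)" for i y
  have "(\<Sum>i<m. stuffle t (g (Suc i)) (u (Suc i)) v) = (\<Sum>i<m. stuffle t (h (Suc i)) (u (Suc i)) v)"
    by (simp add: h_def[abs_def])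
  also have "\<dots> = (\<Sum>i<Suc m. stuffle t (h i) (u i) v)"
    by (simp add: sum.lessThan_Suc_shift h_def[abs_def] stuffle_zero del: sum.lessThan_Suc)
  finally show ?thesis
    unfolding h_def[symmetric]
    by (simp only: stuffle_add stuffle_scale sum.distrib sum_distrib_left atLeast0AtMost lessThan_Suc_atMost)
qed

lemma stuffle_replicate_Cons:
  "stuffle t f (replicate m a) (l # v) =
     (\<Sum>i\<in>{0..m}. stuffle t (\<lambda>y. f (replicate i a @ l # y)
         + t * (if i = 0 then 0 else f (replicate (i - 1) a @ (a + l) # y))) (replicate (m - i) a) v)"
proof -
  have "stuffle t f (replicate m a) (l # v) =
     (\<Sum>i\<le>m. stuffle t (\<lambda>y. f (replicate i a @ l # y)) (replicate (m - i) a) v)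
     + t * (\<Sum>i<m. stuffle t (\<lambda>y. f (replicate (Suc i - 1) a @ (a + l) # y)) (replicate (m - Suc i) a) v)"
    unfolding stuffle_Cons_right by simp
  then show ?thesis
    unfolding sum_stuffle_insert_merge[where f = "\<lambda>i y. f (replicate i a @ l # y)"
      and g = "\<lambda>i y. f (replicate (i - 1) a @ (a + l) # y)" and u = "\<lambda>i. replicate (m - i) a"] .
qed

text \<open>The letter \<open>k\<close> falls into or before the block of letters \<open>a\<close>, merges with the separator \<open>l\<close>, or comes
  after it.\<close>
lemma stuffle_separated_Cons:
  "stuffle t f (replicate n a @ l # u) (k # v) =
     (\<Sum>i\<in>{0..n}. stuffle t (\<lambda>y. f (replicate i a @ k # y)
         + t * (if i = 0 then 0 else f (replicate (i - 1) a @ (a + k) # y))) (replicate (n - i) a @ l # u) v)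
     + t * stuffle t (\<lambda>y. f (replicate n a @ (k + l) # y)) u v
     + stuffle t (\<lambda>w. f (replicate n a @ l # w)) u (k # v)"
proof -
  have "stuffle t f (replicate n a @ l # u) (k # v) =
     (\<Sum>i\<le>n. stuffle t (\<lambda>y. f (replicate i a @ k # y)) (replicate (n - i) a @ l # u) v)
     + t * (\<Sum>i<n. stuffle t (\<lambda>y. f (replicate (Suc i - 1) a @ (a + k) # y)) (replicate (n - Suc i) a @ l # u) v)
     + t * stuffle t (\<lambda>y. f (replicate n a @ (k + l) # y)) u v
     + stuffle t (\<lambda>w. f (replicate n a @ l # w)) u (k # v)"
  proof (induction n arbitrary: f)
    case 0
    show ?case by (simp add: add_ac)
  next
    case (Suc n)
    show ?case
      using Suc[of "\<lambda>w. f (a # w)"]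
      by (simp add: sum.atMost_Suc_shift sum.lessThan_Suc_shift algebra_simps
               del: sum.atMost_Suc sum.lessThan_Suc)
  qed
  then show ?thesis
    unfolding sum_stuffle_insert_merge[where f = "\<lambda>i y. f (replicate i a @ k # y)"
      and g = "\<lambda>i y. f (replicate (i - 1) a @ (a + k) # y)" and u = "\<lambda>i. replicate (n - i) a @ l # u"] .
qed

section \<open>Stuffles with a separated string\<close>

text \<open>The nested stuffles are those that cutting at a distinguished letter produces when all other letters
  equal \<open>p\<close>.\<close>
lemma stuffle_replicate_nested:
  fixes f :: "nat list \<Rightarrow> nat list \<Rightarrow> 'b::comm_ring_1"
  assumes "p > 0"
  shows "stuffle t (\<lambda>x. stuffle t (f x) (replicate a' p) (replicate b' p)) (replicate a p) (replicate b p) =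
    (\<Sum>j1\<in>{0..min a b}. \<Sum>j2\<in>{0..min a' b'}.
     \<Sum>ks\<in>pstrings p (b + a - 2 * j1) j1. \<Sum>ls\<in>pstrings p (a' + b' - 2 * j2) j2.
       t ^ (j1 + j2) * of_nat (b + a - 2 * j1 choose (b - j1)) * of_nat (a' + b' - 2 * j2 choose (b' - j2)) * f ks ls)"
  unfolding stuffle_replicate_replicate[OF assms] add.commute[of b a]
proof (rule sum.cong[OF refl])
  fix j1
  show "(\<Sum>ks\<in>pstrings p (a + b - 2 * j1) j1. t ^ j1 * of_nat (a + b - 2 * j1 choose (b - j1)) *
       (\<Sum>j2\<in>{0..min a' b'}. \<Sum>ls\<in>pstrings p (a' + b' - 2 * j2) j2.
          t ^ j2 * of_nat (a' + b' - 2 * j2 choose (b' - j2)) * f ks ls)) =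
    (\<Sum>j2\<in>{0..min a' b'}. \<Sum>ks\<in>pstrings p (a + b - 2 * j1) j1. \<Sum>ls\<in>pstrings p (a' + b' - 2 * j2) j2.
       t ^ (j1 + j2) * of_nat (a + b - 2 * j1 choose (b - j1)) * of_nat (a' + b' - 2 * j2 choose (b' - j2)) * f ks ls)"
    by (subst sum.swap) (simp add: sum_distrib_left power_add mult_ac)
qed

text \<open>Here \<open>i\<close> counts the letters of the first factor that are used up to and including the separator: in the
  second sum the last of them is merged with \<open>l\<close>, so that only \<open>i - 1\<close> are left for the block in front.\<close>
lemma stuffle_replicate_separated:
  fixes f :: "nat list \<Rightarrow> 'b::comm_ring_1"
  assumes "p > 0"
  shows "stuffle t f (replicate m p) (replicate n1 p @ l # replicate n2 p) =
    (\<Sum>i\<in>{0..m}. \<Sum>j1\<in>{0..min i n1}. \<Sum>j2\<in>{0..min (m - i) n2}.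
       \<Sum>ks\<in>pstrings p (n1 + i - 2 * j1) j1. \<Sum>ls\<in>pstrings p (m + n2 - i - 2 * j2) j2.
       t ^ (j1 + j2) * of_nat (n1 + i - 2 * j1 choose (n1 - j1))
         * of_nat (m + n2 - i - 2 * j2 choose (n2 - j2)) * f (ks @ l # ls))
    + t * (\<Sum>i\<in>{0..m}. \<Sum>j1\<in>{j. j < i \<and> j \<le> n1}. \<Sum>j2\<in>{0..min (m - i) n2}.
       \<Sum>ks\<in>pstrings p (n1 + i - 2 * j1 - 1) j1. \<Sum>ls\<in>pstrings p (m + n2 - i - 2 * j2) j2.
       t ^ (j1 + j2) * of_nat (n1 + i - 2 * j1 - 1 choose (n1 - j1))
         * of_nat (m + n2 - i - 2 * j2 choose (n2 - j2)) * f (ks @ (p + l) # ls))"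
    (is "_ = (\<Sum>i\<in>_. ?A i) + t * (\<Sum>i\<in>_. ?B i)")
proof -
  have A: "stuffle t (\<lambda>x. stuffle t (\<lambda>y. f (x @ l # y)) (replicate (m - i) p) (replicate n2 p))
        (replicate i p) (replicate n1 p) = ?A i" if "i \<le> m" for i
    unfolding stuffle_replicate_nested[OF assms] using that by simp
  have B: "stuffle t (\<lambda>x. stuffle t (\<lambda>y. f (x @ (p + l) # y)) (replicate (m - Suc i) p) (replicate n2 p))
        (replicate i p) (replicate n1 p) = ?B (Suc i)" if "i < m" for i
  proof -
    have "{j. j < Suc i \<and> j \<le> n1} = {0..min i n1}" by auto
    then show ?thesis
      unfolding stuffle_replicate_nested[OF assms] using that by (simp add: Suc_diff_le)
  qed
  have B0: "?B 0 = 0" by simp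
  have "stuffle t f (replicate m p) (replicate n1 p @ l # replicate n2 p) =
     (\<Sum>i\<le>m. ?A i) + t * (\<Sum>i<m. ?B (Suc i))"
    unfolding stuffle_split using A B by simp
  also have "(\<Sum>i<m. ?B (Suc i)) = (\<Sum>i\<le>m. ?B i)"
    using B0 sum.lessThan_Suc_shift[of ?B m] by (simp only: lessThan_Suc_atMost add_0)
  finally show ?thesis
    by (simp only: atLeast0AtMost)
qed

text \<open>The same with \<open>i1\<close> letters already used up, and \<open>i2\<close> counting these as well.\<close>
lemma stuffle_replicate_separated_drop:
  fixes f :: "nat list \<Rightarrow> 'b::comm_ring_1"
  assumes "p > 0" and "i1 \<le> m"
  shows "stuffle t f (replicate (m - i1) p) (replicate n1 p @ l # replicate n2 p) =
    (\<Sum>i2\<in>{i1..m}. \<Sum>j1\<in>{0..min (i2 - i1) n1}. \<Sum>j2\<in>{0..min (m - i2) n2}.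
       \<Sum>ks\<in>pstrings p (n1 + i2 - i1 - 2 * j1) j1. \<Sum>ls\<in>pstrings p (m + n2 - i2 - 2 * j2) j2.
       t ^ (j1 + j2) * of_nat (n1 + i2 - i1 - 2 * j1 choose (n1 - j1))
         * of_nat (m + n2 - i2 - 2 * j2 choose (n2 - j2)) * f (ks @ l # ls))
    + t * (\<Sum>i2\<in>{i1..m}. \<Sum>j1\<in>{j. j < i2 - i1 \<and> j \<le> n1}. \<Sum>j2\<in>{0..min (m - i2) n2}.
       \<Sum>ks\<in>pstrings p (n1 + i2 - i1 - 2 * j1 - 1) j1. \<Sum>ls\<in>pstrings p (m + n2 - i2 - 2 * j2) j2.
       t ^ (j1 + j2) * of_nat (n1 + i2 - i1 - 2 * j1 - 1 choose (n1 - j1))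
         * of_nat (m + n2 - i2 - 2 * j2 choose (n2 - j2)) * f (ks @ (p + l) # ls))"
    (is "_ = (\<Sum>i\<in>_. ?A i) + t * (\<Sum>i\<in>_. ?B i)")
proof -
  have shift: "(\<Sum>i\<in>{i1..m}. F i) = (\<Sum>i\<in>{0..m - i1}. F (i + i1))" for F :: "nat \<Rightarrow> 'b"
    using sum.shift_bounds_cl_nat_ivl[of F 0 i1 "m - i1"] assms(2) by simp
  have *: "m - (i + i1) = m - i1 - i" "n1 + (i + i1) - i1 = n1 + i" "i + i1 - i1 = i"
     "m + n2 - (i + i1) = m - i1 + n2 - i" for i
    using assms(2) by auto
  show ?thesis
    unfolding shift * by (rule stuffle_replicate_separated[OF assms(1)])
qed

text \<open>With the factors in the other order and \<open>i1\<close> letters of the front block used up, the first binomial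
  coefficient is read, by symmetry, as counting the letters of the unseparated string.\<close>
lemma stuffle_separated_replicate:
  fixes f :: "nat list \<Rightarrow> 'b::comm_ring_1"
  assumes "p > 0" and "i1 \<le> n1"
  shows "stuffle t f (replicate (n1 - i1) p @ l # replicate n2 p) (replicate m p) =
    (\<Sum>i2\<in>{0..m}. \<Sum>j1\<in>{0..min i2 (n1 - i1)}. \<Sum>j2\<in>{0..min (m - i2) n2}.
       \<Sum>ks\<in>pstrings p (n1 + i2 - i1 - 2 * j1) j1. \<Sum>ls\<in>pstrings p (m + n2 - i2 - 2 * j2) j2.
       t ^ (j1 + j2) * of_nat (n1 + i2 - i1 - 2 * j1 choose (i2 - j1))
         * of_nat (m + n2 - i2 - 2 * j2 choose (n2 - j2)) * f (ks @ l # ls))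
    + t * (\<Sum>i2\<in>{0..m}. \<Sum>j1\<in>{j. j < i2 \<and> j \<le> n1 - i1}. \<Sum>j2\<in>{0..min (m - i2) n2}.
       \<Sum>ks\<in>pstrings p (n1 + i2 - i1 - 2 * j1 - 1) j1. \<Sum>ls\<in>pstrings p (m + n2 - i2 - 2 * j2) j2.
       t ^ (j1 + j2) * of_nat (n1 + i2 - i1 - 2 * j1 - 1 choose (i2 - j1 - 1))
         * of_nat (m + n2 - i2 - 2 * j2 choose (n2 - j2)) * f (ks @ (p + l) # ls))"
proof -
  have *: "n1 - i1 + i2 = n1 + i2 - i1" for i2
    using assms(2) by simp
  have 1: "(n1 + i2 - i1 - 2 * j1) choose (n1 - i1 - j1) = (n1 + i2 - i1 - 2 * j1) choose (i2 - j1)"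
    if "j1 \<in> {0..min i2 (n1 - i1)}" for i2 j1
  proof -
    have "n1 + i2 - i1 - 2 * j1 = (n1 - i1 - j1) + (i2 - j1)"
      using that assms(2) by auto
    then show ?thesis
      using binomial_symmetric[of "n1 - i1 - j1" "n1 + i2 - i1 - 2 * j1"] by simp
  qed
  have 2: "(n1 + i2 - i1 - 2 * j1 - 1) choose (n1 - i1 - j1) = (n1 + i2 - i1 - 2 * j1 - 1) choose (i2 - j1 - 1)"
    if "j1 \<in> {j. j < i2 \<and> j \<le> n1 - i1}" for i2 j1
  proof -
    have "n1 + i2 - i1 - 2 * j1 - 1 = (n1 - i1 - j1) + (i2 - j1 - 1)"
      using that assms(2) by auto
    then show ?thesis
      using binomial_symmetric[of "n1 - i1 - j1" "n1 + i2 - i1 - 2 * j1 - 1"] by simp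
  qed
  show ?thesis
    unfolding stuffle_commute[of t f "replicate (n1 - i1) p @ l # replicate n2 p"]
      stuffle_replicate_separated[OF assms(1)] *
    by (intro arg_cong2[where f = "(+)"] arg_cong2[where f = "(*)"] sum.cong refl)
       (simp_all only: 1 2)
qed

lemma stuffle_replicate_Cons_replicate:
  fixes f :: "nat list \<Rightarrow> 'b::comm_ring_1"
  assumes "p > 0"
  shows "stuffle t f (replicate m p) (l # replicate n p) =
    (\<Sum>i\<in>{0..m}. \<Sum>j\<in>{0..min n (m - i)}. \<Sum>ks\<in>pstrings p (n + m - i - 2 * j) j.
       t ^ j * of_nat (n + m - i - 2 * j choose (n - j)) *
       (f (replicate i p @ l # ks) + t * (if i = 0 then 0 else f (replicate (i - 1) p @ (p + l) # ks))))"
  unfolding stuffle_replicate_Cons stuffle_replicate_replicate[OF assms]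
proof (rule sum.cong[OF refl])
  fix i assume "i \<in> {0..m}"
  then have *: "m - i + n = n + m - i" by simp
  show "(\<Sum>j\<in>{0..min (m - i) n}. \<Sum>ks\<in>pstrings p (m - i + n - 2 * j) j.
       t ^ j * of_nat (m - i + n - 2 * j choose (n - j)) *
       (f (replicate i p @ l # ks) + t * (if i = 0 then 0 else f (replicate (i - 1) p @ (p + l) # ks)))) =
    (\<Sum>j\<in>{0..min n (m - i)}. \<Sum>ks\<in>pstrings p (n + m - i - 2 * j) j.
       t ^ j * of_nat (n + m - i - 2 * j choose (n - j)) *
       (f (replicate i p @ l # ks) + t * (if i = 0 then 0 else f (replicate (i - 1) p @ (p + l) # ks))))"
    unfolding * min.commute[of "m - i" n] ..
qed

section \<open>Products of two strings with leading letters\<close>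

text \<open>Each word begins with \<open>k\<close>, with \<open>l\<close>, or with the merger of both; in the first two cases the other leading
  letter is inserted in the remaining string.  The words in which the two leading letters are adjacent are
  split off from these insertions, as they share their tails with the words that begin with the merger.\<close>
lemma stuffle_Cons_replicate_Cons_replicate:
  fixes f :: "nat list \<Rightarrow> 'b::comm_ring_1"
  assumes "p > 0"
  shows
    "stuffle t f ([k] @ replicate m p) ([l] @ replicate n p) =
        (\<Sum>i\<in>{1..m}. \<Sum>j\<in>{0..min (m - i) n}. \<Sum>ks\<in>pstrings p (m + n - i - 2 * j) j.
          t ^ j * of_nat (m + n - i - 2 * j choose n - j) *
          (f ([k] @ replicate i p @ [l] @ ks) + t * f ([k] @ replicate (i - 1) p @ [p + l] @ ks)))
      + (\<Sum>i\<in>{1..n}. \<Sum>j\<in>{0..min m (n - i)}. \<Sum>ks\<in>pstrings p (m + n - i - 2 * j) j.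
          t ^ j * of_nat (m + n - i - 2 * j choose m - j) *
          (f ([l] @ replicate i p @ [k] @ ks) + t * f ([l] @ replicate (i - 1) p @ [p + k] @ ks)))
      + (\<Sum>j\<in>{0..min m n}. \<Sum>ks\<in>pstrings p (m + n - 2 * j) j.
          t ^ j * of_nat (m + n - 2 * j choose m - j) *
          (f ([k, l] @ ks) + f ([l, k] @ ks) + t * f ([k + l] @ ks)))"
proof -
  have split: "(\<Sum>i\<in>{0..n}. F i) = (\<Sum>i\<in>{1..n}. F i) + F 0" for F :: "nat \<Rightarrow> 'b" and n
    by (simp add: sum.atLeast_Suc_atMost)
  define X where "X = (\<lambda>a b m n. \<Sum>i\<in>{1..m}. \<Sum>j\<in>{0..min n (m - i)}. \<Sum>ks\<in>pstrings p (n + m - i - 2 * j) j.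
      t ^ j * of_nat (n + m - i - 2 * j choose (n - j)) *
      (f ([a] @ replicate i p @ [b] @ ks) + t * f ([a] @ replicate (i - 1) p @ [p + b] @ ks)))"
  have X: "stuffle t (\<lambda>w. f (a # w)) (replicate m p) (b # replicate n p) =
      X a b m n + stuffle t (\<lambda>y. f ([a, b] @ y)) (replicate m p) (replicate n p)" for a b m n
    unfolding stuffle_replicate_Cons_replicate[OF assms] split X_def
      stuffle_replicate_replicate[OF assms]
    by (simp add: add.commute[of n m] min.commute[of n m])
  \<comment> \<open>The order of the factors decides which of the two equal forms of the binomial coefficient appears.\<close>
  have "stuffle t f ([k] @ replicate m p) ([l] @ replicate n p) =
      X k l m n + X l k n m + stuffle t (\<lambda>y. f ([k, l] @ y) + f ([l, k] @ y) + t * f ([k + l] @ y))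
        (replicate n p) (replicate m p)"
    by (simp only: append_Cons append_Nil stuffle.simps X stuffle_add stuffle_scale
          stuffle_commute[of t _ "k # replicate m p"] stuffle_commute[of t _ "replicate m p" "replicate n p"] add_ac)
  then show ?thesis
    by (simp only: X_def stuffle_replicate_replicate[OF assms] add.commute[of n m] min.commute[of n])
qed

text \<open>Again the first letter is \<open>k\<close>, \<open>l1\<close> or their merger.  If it is \<open>k\<close>, then \<open>l1\<close> is inserted in the string
  of letters \<open>p\<close> (\<open>?T1\<close>, \<open>?T2\<close>, according to whether \<open>l2\<close> merges); if it is \<open>l1\<close>, then \<open>k\<close> is inserted before
  \<open>l2\<close> (\<open>?T3\<close>, \<open>?T4\<close>), merged with it (\<open>?T5\<close>) or inserted after it (\<open>?T6\<close>).
  After the merger only the separated string is left (\<open>?T7\<close>, \<open>?T8\<close>).\<close>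
lemma stuffle_Cons_replicate_separated:
  fixes f :: "nat list \<Rightarrow> 'b::comm_ring_1"
  assumes "p > 0"
  shows
    "stuffle t f ([k] @ replicate m p) ([l1] @ replicate n1 p @ [l2] @ replicate n2 p) =
        (\<Sum>i1\<in>{0..m}. \<Sum>i2\<in>{i1..m}.
          \<Sum>j1\<in>{0..min (i2 - i1) n1}. \<Sum>j2\<in>{0..min (m - i2) n2}.
          \<Sum>ks\<in>pstrings p (n1 + i2 - i1 - 2 * j1) j1. \<Sum>ls\<in>pstrings p (m + n2 - i2 - 2 * j2) j2.
          t ^ (j1 + j2) * of_nat (n1 + i2 - i1 - 2 * j1 choose n1 - j1) * of_nat (m + n2 - i2 - 2 * j2 choose n2 - j2) *
          (f ([k] @ replicate i1 p @ [l1] @ ks @ [l2] @ ls)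
           + t * (if i1 = 0 then 0 else f ([k] @ replicate (i1 - 1) p @ [p + l1] @ ks @ [l2] @ ls))))
      + t * (\<Sum>i1\<in>{0..m}. \<Sum>i2\<in>{i1..m}.
          \<Sum>j1\<in>{j. j < i2 - i1 \<and> j \<le> n1}. \<Sum>j2\<in>{0..min (m - i2) n2}.
          \<Sum>ks\<in>pstrings p (n1 + i2 - i1 - 2 * j1 - 1) j1. \<Sum>ls\<in>pstrings p (m + n2 - i2 - 2 * j2) j2.
          t ^ (j1 + j2) * of_nat (n1 + i2 - i1 - 2 * j1 - 1 choose n1 - j1) * of_nat (m + n2 - i2 - 2 * j2 choose n2 - j2) *
          (f ([k] @ replicate i1 p @ [l1] @ ks @ [p + l2] @ ls)
           + t * (if i1 = 0 then 0 else f ([k] @ replicate (i1 - 1) p @ [p + l1] @ ks @ [p + l2] @ ls))))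
      + (\<Sum>i1\<in>{0..n1}. \<Sum>i2\<in>{0..m}.
          \<Sum>j1\<in>{0..min i2 (n1 - i1)}. \<Sum>j2\<in>{0..min (m - i2) n2}.
          \<Sum>ks\<in>pstrings p (n1 + i2 - i1 - 2 * j1) j1. \<Sum>ls\<in>pstrings p (m + n2 - i2 - 2 * j2) j2.
          t ^ (j1 + j2) * of_nat (n1 + i2 - i1 - 2 * j1 choose i2 - j1) * of_nat (m + n2 - i2 - 2 * j2 choose n2 - j2) *
          (f ([l1] @ replicate i1 p @ [k] @ ks @ [l2] @ ls)
           + t * (if i1 = 0 then 0 else f ([l1] @ replicate (i1 - 1) p @ [p + k] @ ks @ [l2] @ ls))))
      + t * (\<Sum>i1\<in>{0..n1}. \<Sum>i2\<in>{0..m}.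
          \<Sum>j1\<in>{j. j < i2 \<and> j \<le> n1 - i1}. \<Sum>j2\<in>{0..min (m - i2) n2}.
          \<Sum>ks\<in>pstrings p (n1 + i2 - i1 - 2 * j1 - 1) j1. \<Sum>ls\<in>pstrings p (m + n2 - i2 - 2 * j2) j2.
          t ^ (j1 + j2) * of_nat (n1 + i2 - i1 - 2 * j1 - 1 choose i2 - j1 - 1) * of_nat (m + n2 - i2 - 2 * j2 choose n2 - j2) *
          (f ([l1] @ replicate i1 p @ [k] @ ks @ [p + l2] @ ls)
           + t * (if i1 = 0 then 0 else f ([l1] @ replicate (i1 - 1) p @ [p + k] @ ks @ [p + l2] @ ls))))
      + t * (\<Sum>j\<in>{0..min m n2}. \<Sum>ks\<in>pstrings p (m + n2 - 2 * j) j.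
          t ^ j * of_nat (m + n2 - 2 * j choose m - j) *
          f ([l1] @ replicate n1 p @ [k + l2] @ ks))
      + (\<Sum>i\<in>{0..n2}. \<Sum>j\<in>{0..min m (n2 - i)}. \<Sum>ks\<in>pstrings p (m + n2 - i - 2 * j) j.
          t ^ j * of_nat (m + n2 - i - 2 * j choose m - j) *
          (f ([l1] @ replicate n1 p @ [l2] @ replicate i p @ [k] @ ks)
           + t * (if i = 0 then 0 else f ([l1] @ replicate n1 p @ [l2] @ replicate (i - 1) p @ [p + k] @ ks))))
      + t * (\<Sum>i\<in>{0..m}. \<Sum>j1\<in>{0..min i n1}. \<Sum>j2\<in>{0..min (m - i) n2}.
          \<Sum>ks\<in>pstrings p (n1 + i - 2 * j1) j1. \<Sum>ls\<in>pstrings p (m + n2 - i - 2 * j2) j2.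
          t ^ (j1 + j2) * of_nat (n1 + i - 2 * j1 choose n1 - j1) * of_nat (m + n2 - i - 2 * j2 choose n2 - j2) *
          f ([k + l1] @ ks @ [l2] @ ls))
      + t * t * (\<Sum>i\<in>{0..m}. \<Sum>j1\<in>{j. j < i \<and> j \<le> n1}. \<Sum>j2\<in>{0..min (m - i) n2}.
          \<Sum>ks\<in>pstrings p (n1 + i - 2 * j1 - 1) j1. \<Sum>ls\<in>pstrings p (m + n2 - i - 2 * j2) j2.
          t ^ (j1 + j2) * of_nat (n1 + i - 2 * j1 - 1 choose n1 - j1) * of_nat (m + n2 - i - 2 * j2 choose n2 - j2) *
          f ([k + l1] @ ks @ [p + l2] @ ls))"
    (is "_ = ?T1 + t * ?T2 + ?T3 + t * ?T4 + t * ?T5 + ?T6 + t * ?T7 + t * t * ?T8")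
proof -
  let ?v = "replicate n1 p @ l2 # replicate n2 p"
  have "stuffle t (\<lambda>w. f (k # w)) (replicate m p) (l1 # ?v) = ?T1 + t * ?T2"
    unfolding stuffle_replicate_Cons[of t _ m] sum_distrib_left[of t _ "{0..m}"] sum.distrib[symmetric]
    by (intro sum.cong[OF refl], subst stuffle_replicate_separated_drop[OF assms])
         (simp_all only: atLeastAtMost_iff append_Cons append_Nil append_assoc cong: if_cong)
  moreover have "stuffle t (\<lambda>w. f (l1 # w)) ?v (k # replicate m p) = (?T3 + t * ?T4) + t * ?T5 + ?T6"
  proof (unfold stuffle_separated_Cons, intro arg_cong2[where f = "(+)"] arg_cong2[where f = "(*)"] refl)
    show "(\<Sum>i\<in>{0..n1}. stuffle t (\<lambda>y. f (l1 # replicate i p @ k # y)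
         + t * (if i = 0 then 0 else f (l1 # replicate (i - 1) p @ (p + k) # y)))
           (replicate (n1 - i) p @ l2 # replicate n2 p) (replicate m p)) = ?T3 + t * ?T4"
      unfolding sum_distrib_left[of t _ "{0..n1}"] sum.distrib[symmetric]
      by (intro sum.cong[OF refl], subst stuffle_separated_replicate[OF assms])
         (simp_all only: atLeastAtMost_iff append_Cons append_Nil append_assoc cong: if_cong)
    show "stuffle t (\<lambda>y. f (l1 # replicate n1 p @ (k + l2) # y)) (replicate n2 p) (replicate m p) = ?T5"
      unfolding stuffle_replicate_replicate[OF assms] by (simp only: add.commute[of n2] min.commute[of n2] append_Cons append_Nil)
    show "stuffle t (\<lambda>w. f (l1 # replicate n1 p @ l2 # w)) (replicate n2 p) (k # replicate m p) = ?T6"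
      unfolding stuffle_replicate_Cons_replicate[OF assms]
      by (simp only: append_Cons append_Nil cong: if_cong)
  qed
  moreover have "stuffle t (\<lambda>w. f ((k + l1) # w)) (replicate m p) ?v = ?T7 + t * ?T8"
    unfolding stuffle_replicate_separated[OF assms] by (simp only: append_Cons append_Nil)
  ultimately show ?thesis
    unfolding append_Cons append_Nil stuffle.simps stuffle_commute[of t _ "k # replicate m p"]
    by (simp only: distrib_left add.assoc mult.assoc)
qed

theorem corollary1p5:
  fixes p k l l1 l2 m n n1 n2 :: nat
  assumes "p > 0"
    and "k \<ge> 2" and "l \<ge> 2" and "l1 \<ge> 2" and "l2 > 0"
  shows
    "(mzv ([k] @ replicate m p) * mzv ([l] @ replicate n p) =
        (\<Sum>i\<in>{1..m}. \<Sum>j\<in>{0..min (m - i) n}. \<Sum>ks\<in>pstrings p (m + n - i - 2 * j) j.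
          real (m + n - i - 2 * j choose n - j) *
          (mzv ([k] @ replicate i p @ [l] @ ks) + mzv ([k] @ replicate (i - 1) p @ [p + l] @ ks)))
      + (\<Sum>i\<in>{1..n}. \<Sum>j\<in>{0..min m (n - i)}. \<Sum>ks\<in>pstrings p (m + n - i - 2 * j) j.
          real (m + n - i - 2 * j choose m - j) *
          (mzv ([l] @ replicate i p @ [k] @ ks) + mzv ([l] @ replicate (i - 1) p @ [p + k] @ ks)))
      + (\<Sum>j\<in>{0..min m n}. \<Sum>ks\<in>pstrings p (m + n - 2 * j) j.
          real (m + n - 2 * j choose m - j) *
          (mzv ([k, l] @ ks) + mzv ([l, k] @ ks) + mzv ([k + l] @ ks))))
     \<and>
     (mzsv ([k] @ replicate m p) * mzsv ([l] @ replicate n p) =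
        (\<Sum>i\<in>{1..m}. \<Sum>j\<in>{0..min (m - i) n}. \<Sum>ks\<in>pstrings p (m + n - i - 2 * j) j.
          (-1) ^ j * real (m + n - i - 2 * j choose n - j) *
          (mzsv ([k] @ replicate i p @ [l] @ ks) - mzsv ([k] @ replicate (i - 1) p @ [p + l] @ ks)))
      + (\<Sum>i\<in>{1..n}. \<Sum>j\<in>{0..min m (n - i)}. \<Sum>ks\<in>pstrings p (m + n - i - 2 * j) j.
          (-1) ^ j * real (m + n - i - 2 * j choose m - j) *
          (mzsv ([l] @ replicate i p @ [k] @ ks) - mzsv ([l] @ replicate (i - 1) p @ [p + k] @ ks)))
      + (\<Sum>j\<in>{0..min m n}. \<Sum>ks\<in>pstrings p (m + n - 2 * j) j.
          (-1) ^ j * real (m + n - 2 * j choose m - j) *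
          (mzsv ([k, l] @ ks) + mzsv ([l, k] @ ks) - mzsv ([k + l] @ ks))))
     \<and>
     (mzv ([k] @ replicate m p) * mzv ([l1] @ replicate n1 p @ [l2] @ replicate n2 p) =
        (\<Sum>i1\<in>{0..m}. \<Sum>i2\<in>{i1..m}.
          \<Sum>j1\<in>{0..min (i2 - i1) n1}. \<Sum>j2\<in>{0..min (m - i2) n2}.
          \<Sum>ks\<in>pstrings p (n1 + i2 - i1 - 2 * j1) j1. \<Sum>ls\<in>pstrings p (m + n2 - i2 - 2 * j2) j2.
          real (n1 + i2 - i1 - 2 * j1 choose n1 - j1) * real (m + n2 - i2 - 2 * j2 choose n2 - j2) *
          (mzv ([k] @ replicate i1 p @ [l1] @ ks @ [l2] @ ls)
           + (if i1 = 0 then 0 else mzv ([k] @ replicate (i1 - 1) p @ [p + l1] @ ks @ [l2] @ ls))))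
      + (\<Sum>i1\<in>{0..m}. \<Sum>i2\<in>{i1..m}.
          \<Sum>j1\<in>{j. j < i2 - i1 \<and> j \<le> n1}. \<Sum>j2\<in>{0..min (m - i2) n2}.
          \<Sum>ks\<in>pstrings p (n1 + i2 - i1 - 2 * j1 - 1) j1. \<Sum>ls\<in>pstrings p (m + n2 - i2 - 2 * j2) j2.
          real (n1 + i2 - i1 - 2 * j1 - 1 choose n1 - j1) * real (m + n2 - i2 - 2 * j2 choose n2 - j2) *
          (mzv ([k] @ replicate i1 p @ [l1] @ ks @ [p + l2] @ ls)
           + (if i1 = 0 then 0 else mzv ([k] @ replicate (i1 - 1) p @ [p + l1] @ ks @ [p + l2] @ ls))))
      + (\<Sum>i1\<in>{0..n1}. \<Sum>i2\<in>{0..m}.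
          \<Sum>j1\<in>{0..min i2 (n1 - i1)}. \<Sum>j2\<in>{0..min (m - i2) n2}.
          \<Sum>ks\<in>pstrings p (n1 + i2 - i1 - 2 * j1) j1. \<Sum>ls\<in>pstrings p (m + n2 - i2 - 2 * j2) j2.
          real (n1 + i2 - i1 - 2 * j1 choose i2 - j1) * real (m + n2 - i2 - 2 * j2 choose n2 - j2) *
          (mzv ([l1] @ replicate i1 p @ [k] @ ks @ [l2] @ ls)
           + (if i1 = 0 then 0 else mzv ([l1] @ replicate (i1 - 1) p @ [p + k] @ ks @ [l2] @ ls))))
      + (\<Sum>i1\<in>{0..n1}. \<Sum>i2\<in>{0..m}.
          \<Sum>j1\<in>{j. j < i2 \<and> j \<le> n1 - i1}. \<Sum>j2\<in>{0..min (m - i2) n2}.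
          \<Sum>ks\<in>pstrings p (n1 + i2 - i1 - 2 * j1 - 1) j1. \<Sum>ls\<in>pstrings p (m + n2 - i2 - 2 * j2) j2.
          real (n1 + i2 - i1 - 2 * j1 - 1 choose i2 - j1 - 1) * real (m + n2 - i2 - 2 * j2 choose n2 - j2) *
          (mzv ([l1] @ replicate i1 p @ [k] @ ks @ [p + l2] @ ls)
           + (if i1 = 0 then 0 else mzv ([l1] @ replicate (i1 - 1) p @ [p + k] @ ks @ [p + l2] @ ls))))
      + (\<Sum>j\<in>{0..min m n2}. \<Sum>ks\<in>pstrings p (m + n2 - 2 * j) j.
          real (m + n2 - 2 * j choose m - j) *
          mzv ([l1] @ replicate n1 p @ [k + l2] @ ks))
      + (\<Sum>i\<in>{0..n2}. \<Sum>j\<in>{0..min m (n2 - i)}. \<Sum>ks\<in>pstrings p (m + n2 - i - 2 * j) j.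
          real (m + n2 - i - 2 * j choose m - j) *
          (mzv ([l1] @ replicate n1 p @ [l2] @ replicate i p @ [k] @ ks)
           + (if i = 0 then 0 else mzv ([l1] @ replicate n1 p @ [l2] @ replicate (i - 1) p @ [p + k] @ ks))))
      + (\<Sum>i\<in>{0..m}. \<Sum>j1\<in>{0..min i n1}. \<Sum>j2\<in>{0..min (m - i) n2}.
          \<Sum>ks\<in>pstrings p (n1 + i - 2 * j1) j1. \<Sum>ls\<in>pstrings p (m + n2 - i - 2 * j2) j2.
          real (n1 + i - 2 * j1 choose n1 - j1) * real (m + n2 - i - 2 * j2 choose n2 - j2) *
          mzv ([k + l1] @ ks @ [l2] @ ls))
      + (\<Sum>i\<in>{0..m}. \<Sum>j1\<in>{j. j < i \<and> j \<le> n1}. \<Sum>j2\<in>{0..min (m - i) n2}.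
          \<Sum>ks\<in>pstrings p (n1 + i - 2 * j1 - 1) j1. \<Sum>ls\<in>pstrings p (m + n2 - i - 2 * j2) j2.
          real (n1 + i - 2 * j1 - 1 choose n1 - j1) * real (m + n2 - i - 2 * j2 choose n2 - j2) *
          mzv ([k + l1] @ ks @ [p + l2] @ ls)))
     \<and>
     (mzsv ([k] @ replicate m p) * mzsv ([l1] @ replicate n1 p @ [l2] @ replicate n2 p) =
        (\<Sum>i1\<in>{0..m}. \<Sum>i2\<in>{i1..m}.
          \<Sum>j1\<in>{0..min (i2 - i1) n1}. \<Sum>j2\<in>{0..min (m - i2) n2}.
          \<Sum>ks\<in>pstrings p (n1 + i2 - i1 - 2 * j1) j1. \<Sum>ls\<in>pstrings p (m + n2 - i2 - 2 * j2) j2.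
          (-1) ^ (j1 + j2) * real (n1 + i2 - i1 - 2 * j1 choose n1 - j1) * real (m + n2 - i2 - 2 * j2 choose n2 - j2) *
          (mzsv ([k] @ replicate i1 p @ [l1] @ ks @ [l2] @ ls)
           - (if i1 = 0 then 0 else mzsv ([k] @ replicate (i1 - 1) p @ [p + l1] @ ks @ [l2] @ ls))))
      - (\<Sum>i1\<in>{0..m}. \<Sum>i2\<in>{i1..m}.
          \<Sum>j1\<in>{j. j < i2 - i1 \<and> j \<le> n1}. \<Sum>j2\<in>{0..min (m - i2) n2}.
          \<Sum>ks\<in>pstrings p (n1 + i2 - i1 - 2 * j1 - 1) j1. \<Sum>ls\<in>pstrings p (m + n2 - i2 - 2 * j2) j2.
          (-1) ^ (j1 + j2) * real (n1 + i2 - i1 - 2 * j1 - 1 choose n1 - j1) * real (m + n2 - i2 - 2 * j2 choose n2 - j2) *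
          (mzsv ([k] @ replicate i1 p @ [l1] @ ks @ [p + l2] @ ls)
           - (if i1 = 0 then 0 else mzsv ([k] @ replicate (i1 - 1) p @ [p + l1] @ ks @ [p + l2] @ ls))))
      + (\<Sum>i1\<in>{0..n1}. \<Sum>i2\<in>{0..m}.
          \<Sum>j1\<in>{0..min i2 (n1 - i1)}. \<Sum>j2\<in>{0..min (m - i2) n2}.
          \<Sum>ks\<in>pstrings p (n1 + i2 - i1 - 2 * j1) j1. \<Sum>ls\<in>pstrings p (m + n2 - i2 - 2 * j2) j2.
          (-1) ^ (j1 + j2) * real (n1 + i2 - i1 - 2 * j1 choose i2 - j1) * real (m + n2 - i2 - 2 * j2 choose n2 - j2) *
          (mzsv ([l1] @ replicate i1 p @ [k] @ ks @ [l2] @ ls)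
           - (if i1 = 0 then 0 else mzsv ([l1] @ replicate (i1 - 1) p @ [p + k] @ ks @ [l2] @ ls))))
      - (\<Sum>i1\<in>{0..n1}. \<Sum>i2\<in>{0..m}.
          \<Sum>j1\<in>{j. j < i2 \<and> j \<le> n1 - i1}. \<Sum>j2\<in>{0..min (m - i2) n2}.
          \<Sum>ks\<in>pstrings p (n1 + i2 - i1 - 2 * j1 - 1) j1. \<Sum>ls\<in>pstrings p (m + n2 - i2 - 2 * j2) j2.
          (-1) ^ (j1 + j2) * real (n1 + i2 - i1 - 2 * j1 - 1 choose i2 - j1 - 1) * real (m + n2 - i2 - 2 * j2 choose n2 - j2) *
          (mzsv ([l1] @ replicate i1 p @ [k] @ ks @ [p + l2] @ ls)
           - (if i1 = 0 then 0 else mzsv ([l1] @ replicate (i1 - 1) p @ [p + k] @ ks @ [p + l2] @ ls))))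
      - (\<Sum>j\<in>{0..min m n2}. \<Sum>ks\<in>pstrings p (m + n2 - 2 * j) j.
          (-1) ^ j * real (m + n2 - 2 * j choose m - j) *
          mzsv ([l1] @ replicate n1 p @ [k + l2] @ ks))
      + (\<Sum>i\<in>{0..n2}. \<Sum>j\<in>{0..min m (n2 - i)}. \<Sum>ks\<in>pstrings p (m + n2 - i - 2 * j) j.
          (-1) ^ j * real (m + n2 - i - 2 * j choose m - j) *
          (mzsv ([l1] @ replicate n1 p @ [l2] @ replicate i p @ [k] @ ks)
           - (if i = 0 then 0 else mzsv ([l1] @ replicate n1 p @ [l2] @ replicate (i - 1) p @ [p + k] @ ks))))
      - (\<Sum>i\<in>{0..m}. \<Sum>j1\<in>{0..min i n1}. \<Sum>j2\<in>{0..min (m - i) n2}.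
          \<Sum>ks\<in>pstrings p (n1 + i - 2 * j1) j1. \<Sum>ls\<in>pstrings p (m + n2 - i - 2 * j2) j2.
          (-1) ^ (j1 + j2) * real (n1 + i - 2 * j1 choose n1 - j1) * real (m + n2 - i - 2 * j2 choose n2 - j2) *
          mzsv ([k + l1] @ ks @ [l2] @ ls))
      + (\<Sum>i\<in>{0..m}. \<Sum>j1\<in>{j. j < i \<and> j \<le> n1}. \<Sum>j2\<in>{0..min (m - i) n2}.
          \<Sum>ks\<in>pstrings p (n1 + i - 2 * j1 - 1) j1. \<Sum>ls\<in>pstrings p (m + n2 - i - 2 * j2) j2.
          (-1) ^ (j1 + j2) * real (n1 + i - 2 * j1 - 1 choose n1 - j1) * real (m + n2 - i - 2 * j2 choose n2 - j2) *
          mzsv ([k + l1] @ ks @ [p + l2] @ ls)))"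
proof -
  have adm: "admissible ([a] @ replicate m p)" "admissible ([a] @ replicate m p @ [l2] @ replicate n p)"
    if "a \<ge> 2" for a m n
    using assms that by (auto simp: admissible_def list_all_iff)
  note signs = mult_minus1 minus_minus add_uminus_conv_diff
  show ?thesis
  proof (intro conjI, goal_cases)
    case 1
    show ?case
      unfolding mzv_mult[OF adm(1)[OF assms(2)] adm(1)[OF assms(3)]]
        stuffle_Cons_replicate_Cons_replicate[OF assms(1)]
      by (simp only: power_one mult_1_left)
  next
    case 2
    show ?case
      unfolding mzsv_mult[OF adm(1)[OF assms(2)] adm(1)[OF assms(3)]]
        stuffle_Cons_replicate_Cons_replicate[OF assms(1)]
      by (simp only: signs)
  next
    case 3
    show ?case
      unfolding mzv_mult[OF adm(1)[OF assms(2)] adm(2)[OF assms(4)]]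
        stuffle_Cons_replicate_separated[OF assms(1)]
      by (simp only: power_one mult_1_left)
  next
    case 4
    show ?case
      unfolding mzsv_mult[OF adm(1)[OF assms(2)] adm(2)[OF assms(4)]]
        stuffle_Cons_replicate_separated[OF assms(1)]
      by (simp only: signs mult_1_left)
  qed
qed

end
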